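(* (1) The $h$-vector of an $h$-tiling on a closed triangulated manifold is palindromic if and only if its $c$-vector is palindromic. (2) Likewise, the $h$-vector of a Morse tiling on a closed triangulated manifold of dimension less than four is palindromic if and only if its $c$-vector is palindromic.
   Context: A closed triangulated manifold is a finite simplicial complex $K$ whose underlying topological space $|K|$ is homeomorphic to a closed manifold. A facet of a simplex is a codimension one face. A basic tile of dimension $n$ and order $k\in\{0,\dots,n+1\}$ is a closed $n$-simplex deprived of $k$ of its facets. A Morse tile of dimension $n$ and order $k$ is a closed $n$-simplex deprived of $k$ of its facets together with, if $k\ge 1$, a possibly empty face $\mu$ of codimension at least two (the Morse face); when $\mu$ is non-empty it is understood not to be contained in the removed facets, so that $k-1\le\dim\mu\le n-2$. Critical tiles: the closed simplex is critical of index $0$; the open $n$-simplex (order $n+1$) is critical of index $n$; a Morse tile of order $k$, $1\le k\le n-1$, whose Morse face has dimension $k-1$ is critical of index $k$; all other Morse tiles are regular. A Morse tiling of a finite simplicial complex $K$ is a partition of $|K|$ by Morse tiles, each obtained from a simplex of $K$, such that for every $j\ge 0$ the union of the tiles of dimension $\ge j$ is closed; it is an $h$-tiling if all tiles are basic. For an $n$-dimensional Morse tiling $\tau$, the $h$-vector is $h(\tau)=(h_0(\tau),\dots,h_{n+1}(\tau))$, with $h_k(\tau)$ the number of tiles of order $k$, and the $c$-vector is $c(\tau)=(c_0(\tau),\dots,c_n(\tau))$, with $c_k(\tau)$ the number of critical tiles of index $k$. A vector $(v_0,\dots,v_N)$ is palindromic if $v_i=v_{N-i}$ for all $i$. *)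

theory Defs
  imports "HOL-Analysis.Analysis"
begin

(* Topological manifold: no orientability, connectedness or smoothness is required. *)
definition closed_manifold :: "nat \<Rightarrow> 'a topology \<Rightarrow> bool" where
  "closed_manifold n X \<longleftrightarrow>
     compact_space X \<and> Hausdorff_space X \<and> second_countable X \<and>
     (\<forall>x\<in>topspace X. \<exists>U. openin X U \<and> x \<in> U \<and>
        subtopology X U homeomorphic_space Euclidean_space n)"

definition closed_triangulated_manifold :: "nat \<Rightarrow> 'a::euclidean_space set set \<Rightarrow> bool" where
  "closed_triangulated_manifold n K \<longleftrightarrow>
     simplicial_complex K \<and> closed_manifold n (top_of_set (\<Union>K))"

(* Differs from the library predicate facet_of only for a vertex, whose empty face counts
   as a facet here: an n-simplex has n + 1 facets also for n = 0.  Hence a single point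
   is a basic tile both of order 0 and of order 1. *)
definition facets :: "'a::euclidean_space set \<Rightarrow> 'a set set" where
  "facets \<sigma> = {F. F face_of \<sigma> \<and> aff_dim F = aff_dim \<sigma> - 1}"

definition basic_tile :: "'a::euclidean_space set \<Rightarrow> nat \<Rightarrow> nat \<Rightarrow> 'a set \<Rightarrow> bool" where
  "basic_tile \<sigma> n k T \<longleftrightarrow>
     int n simplex \<sigma> \<and> (\<exists>R. R \<subseteq> facets \<sigma> \<and> card R = k \<and> T = \<sigma> - \<Union>R)"

(* \<mu> is the Morse face; \<mu> = {} gives the basic tiles. *)
definition morse_tile_with ::
    "'a::euclidean_space set \<Rightarrow> nat \<Rightarrow> nat \<Rightarrow> 'a set \<Rightarrow> 'a set \<Rightarrow> bool" where
  "morse_tile_with \<sigma> n k \<mu> T \<longleftrightarrow>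
     int n simplex \<sigma> \<and>
     (\<exists>R. R \<subseteq> facets \<sigma> \<and> card R = k \<and> T = \<sigma> - \<Union>R - \<mu> \<and>
        (\<mu> \<noteq> {} \<longrightarrow> k \<ge> 1 \<and> \<mu> face_of \<sigma> \<and> aff_dim \<mu> \<le> int n - 2 \<and> (\<forall>F\<in>R. \<not> \<mu> \<subseteq> F)))"

definition morse_tile :: "'a::euclidean_space set \<Rightarrow> nat \<Rightarrow> nat \<Rightarrow> 'a set \<Rightarrow> bool" where
  "morse_tile \<sigma> n k T \<longleftrightarrow> (\<exists>\<mu>. morse_tile_with \<sigma> n k \<mu> T)"

definition critical_tile :: "'a::euclidean_space set \<Rightarrow> nat \<Rightarrow> nat \<Rightarrow> 'a set \<Rightarrow> bool" where
  "critical_tile \<sigma> n i T \<longleftrightarrow>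
     i = 0 \<and> basic_tile \<sigma> n 0 T \<or>
     i = n \<and> basic_tile \<sigma> n (n + 1) T \<or>
     1 \<le> i \<and> i < n \<and> (\<exists>\<mu>. morse_tile_with \<sigma> n i \<mu> T \<and> aff_dim \<mu> = int i - 1)"

definition morse_tiling :: "'a::euclidean_space set set \<Rightarrow> 'a set set \<Rightarrow> bool" where
  "morse_tiling K \<tau> \<longleftrightarrow>
     partition_on (\<Union>K) \<tau> \<and>
     (\<forall>T\<in>\<tau>. \<exists>\<sigma>\<in>K. \<exists>n k. morse_tile \<sigma> n k T) \<and>
     (\<forall>j. closedin (top_of_set (\<Union>K))
            (\<Union>{T\<in>\<tau>. \<exists>\<sigma>\<in>K. \<exists>n k. n \<ge> j \<and> morse_tile \<sigma> n k T}))"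

definition h_tiling :: "'a::euclidean_space set set \<Rightarrow> 'a set set \<Rightarrow> bool" where
  "h_tiling K \<tau> \<longleftrightarrow>
     morse_tiling K \<tau> \<and> (\<forall>T\<in>\<tau>. \<exists>\<sigma>\<in>K. \<exists>n k. basic_tile \<sigma> n k T)"

definition h_vector :: "'a::euclidean_space set set \<Rightarrow> 'a set set \<Rightarrow> nat \<Rightarrow> nat" where
  "h_vector K \<tau> k = card {T\<in>\<tau>. \<exists>\<sigma>\<in>K. \<exists>n. morse_tile \<sigma> n k T}"

definition c_vector :: "'a::euclidean_space set set \<Rightarrow> 'a set set \<Rightarrow> nat \<Rightarrow> nat" where
  "c_vector K \<tau> i = card {T\<in>\<tau>. \<exists>\<sigma>\<in>K. \<exists>n. critical_tile \<sigma> n i T}"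

definition palindromic :: "nat \<Rightarrow> (nat \<Rightarrow> nat) \<Rightarrow> bool" where
  "palindromic N v \<longleftrightarrow> (\<forall>i\<le>N. v i = v (N - i))"

end

theory Submission
  imports Defs "HOL-Homology.Homology"
begin

text \<open>
  Write \<open>d = n + 1\<close>.  A tile cut out of an \<open>n\<close>-simplex with vertex set \<open>V\<close> is a union of open faces.
  If \<open>W\<close> is the set of vertices opposite to the removed facets and \<open>M\<close> the vertex set of the Morse
  face, the faces that remain are those spanned by the sets \<open>U\<close> with \<open>W \<subseteq> U \<subseteq> V\<close> and
  \<open>\<not> U \<subseteq> M\<close>.  The order of the tile is \<open>card W\<close>, and for orders strictly between \<open>0\<close> and \<open>n\<close> the
  tile is critical exactly if \<open>M = W\<close>.  So a tiling writes every sum over the simplices of the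
  complex as a sum over tiles, and both vectors become statements about counting faces.

  The only topological input is that in a closed \<open>n\<close>-manifold every non-empty simplex \<open>\<sigma>\<close> satisfies
  \<open>\<Sum>\<rho>\<supseteq>\<sigma>. (-1) ^ card \<rho> = (-1) ^ d\<close> (\<open>manifold_star_euler_char\<close>).  For \<open>x\<close> in the relative interior
  of \<open>\<sigma>\<close>, the punctured polyhedron deformation retracts onto the union of the simplices that miss
  \<open>x\<close> (\<open>punctured_complex_retraction\<close>).  If \<open>x\<close> has a neighbourhood homeomorphic to Euclidean
  \<open>k\<close>-space, then the homology relative to the complement of \<open>x\<close> is infinite cyclic in degree \<open>k\<close> and
  trivial otherwise, so by the long exact sequence putting \<open>x\<close> back changes the Euler
  characteristic, the alternating sum of the ranks of the homology groups, by \<open>(-1) ^ k\<close>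
  (\<open>has_euler_char_add_cell\<close>).  With \<open>x\<close> inside a maximal simplex this evaluates the Euler
  characteristic of a finite complex as the alternating number of its simplices; with \<open>x\<close> an
  arbitrary point of the manifold it then gives the formula.

  Summing the formula over all \<open>\<sigma>\<close> with a weight that depends on \<open>card \<sigma>\<close> gives the
  Dehn--Sommerville relations (\<open>weighted_dehn_sommerville\<close>).  With weight \<open>x ^ card \<sigma>\<close> they say that
  \<open>F x = (\<Sum>\<sigma>. x ^ card \<sigma>)\<close> satisfies \<open>F (- 1 - x) = (-1) ^ d * F x\<close> up to a constant.  For an h-tiling
  \<open>F x + h 0 = (\<Sum>k\<le>d. h k * x ^ k * (1 + x) ^ (d - k))\<close>, and \<open>x \<mapsto> - 1 - x\<close> exchanges the \<open>k\<close>-th and the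
  \<open>(d - k)\<close>-th summand up to the sign \<open>(-1) ^ d\<close>.  Hence \<open>h (d - k) - h k\<close> vanishes for all \<open>k\<close> as
  soon as it does for \<open>k = 0\<close>.  All critical tiles of an h-tiling have index \<open>0\<close> or \<open>n\<close>, so
  \<open>h 0 = h d\<close> is also what it means that the c-vector is palindromic.

  For a Morse tiling with \<open>n \<le> 3\<close> two weights are enough: counting incidences between
  \<open>n\<close>-simplices and their facets gives \<open>\<Sum>k\<le>d. h k * (d - 2 * k) = 0\<close>, and for odd \<open>n\<close> the Euler
  characteristic vanishes, which makes the alternating sum of the c-vector zero.  Either
  palindromicity again comes down to \<open>h 0 = h d\<close>.
\<close>


section \<open>Rank of an abelian group\<close>

text \<open>
  The preimage of the rational span of \<open>A\<close> under the map from \<open>G\<close> to its rationalisation.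
\<close>

definition isolated_hull :: "('a, 'b) monoid_scheme \<Rightarrow> 'a set \<Rightarrow> 'a set" where
  "isolated_hull G A = {g \<in> carrier G. \<exists>m::nat. m > 0 \<and> g [^]\<^bsub>G\<^esub> m \<in> generate G A}"

lemma isolated_hull_carrier: "isolated_hull G A \<subseteq> carrier G"
  by (auto simp: isolated_hull_def)

lemma (in comm_group) generate_insertD:
  assumes A: "A \<subseteq> carrier G" and t: "t \<in> carrier G" and x: "x \<in> generate G (insert t A)"
  shows "\<exists>a\<in>generate G A. \<exists>k::int. x = a \<otimes> t [^] k"
  using x
proof (induction rule: generate.induct)
  case one
  then show ?case using generate.one[of G A] by (intro bexI[of _ \<one>] exI[of _ 0]) auto
next
  case (incl h)
  show ?case
  proof (cases "h = t")
    case True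
    then show ?thesis using t generate.one[of G A] by (intro bexI[of _ \<one>] exI[of _ 1]) auto
  next
    case False
    then have "h \<in> generate G A" "h \<in> carrier G" using incl A by (auto intro: generate.incl)
    then show ?thesis by (intro bexI[of _ h] exI[of _ 0]) auto
  qed
next
  case (inv h)
  show ?case
  proof (cases "h = t")
    case True
    then show ?thesis using t generate.one[of G A]
      by (intro bexI[of _ \<one>] exI[of _ "-1"]) (auto simp: int_pow_neg)
  next
    case False
    then have "inv h \<in> generate G A" "inv h \<in> carrier G" using inv A by (auto intro: generate.inv)
    then show ?thesis by (intro bexI[of _ "inv h"] exI[of _ 0]) auto
  qed
next
  case (eng h1 h2)
  then obtain a k b l where a: "a \<in> generate G A" and b: "b \<in> generate G A"
    and h: "h1 = a \<otimes> t [^] (k::int)" "h2 = b \<otimes> t [^] (l::int)" by blast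
  have c: "a \<in> carrier G" "b \<in> carrier G"
    using a b generate_in_carrier[OF A] by auto
  have "h1 \<otimes> h2 = (a \<otimes> b) \<otimes> t [^] (k + l)"
    using c t unfolding h by (simp add: int_pow_mult m_ac)
  then show ?case using generate.eng[OF a b] by blast
qed

lemma (in comm_group) subgroup_isolated_hull:
  assumes A: "A \<subseteq> carrier G"
  shows "subgroup (isolated_hull G A) G"
proof (rule subgroupI)
  interpret S: subgroup "generate G A" G by (rule generate_is_subgroup[OF A])
  show "isolated_hull G A \<subseteq> carrier G" by (rule isolated_hull_carrier)
  show "isolated_hull G A \<noteq> {}" using generate.one[of G A]
    by (auto simp: isolated_hull_def intro!: exI[of _ \<one>] exI[of _ "1::nat"])
  show "inv a \<in> isolated_hull G A" if "a \<in> isolated_hull G A" for a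
    using that S.m_inv_closed by (auto simp: isolated_hull_def nat_pow_inv)
  show "a \<otimes> b \<in> isolated_hull G A" if a: "a \<in> isolated_hull G A" and b: "b \<in> isolated_hull G A" for a b
  proof -
    obtain m l :: nat where ml: "m > 0" "l > 0" "a [^] m \<in> generate G A" "b [^] l \<in> generate G A"
      and c: "a \<in> carrier G" "b \<in> carrier G"
      using a b by (auto simp: isolated_hull_def)
    have pw: "x [^] n \<in> generate G A" if "x \<in> generate G A" for x and n :: nat
      using that by (induction n) (auto simp: generate.eng generate.one)
    have "(a \<otimes> b) [^] (m * l) = (a [^] m) [^] l \<otimes> (b [^] l) [^] m"
      using c by (simp add: pow_mult_distrib m_comm nat_pow_pow mult.commute)
    also have "\<dots> \<in> generate G A" using ml pw by (simp add: generate.eng)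
    finally show ?thesis using c ml by (auto simp: isolated_hull_def intro!: exI[of _ "m * l"])
  qed
qed

lemma (in comm_group) isolated_hull_superset: "A \<subseteq> carrier G \<Longrightarrow> A \<subseteq> isolated_hull G A"
  by (auto simp: isolated_hull_def intro!: exI[of _ "1::nat"] generate.incl)

lemma (in comm_group) isolated_hullI:
  assumes "A \<subseteq> carrier G" "g \<in> carrier G" "m > 0" "g [^] (m::nat) \<in> isolated_hull G A"
  shows "g \<in> isolated_hull G A"
proof -
  obtain l :: nat where "l > 0" "(g [^] m) [^] l \<in> generate G A"
    using assms by (auto simp: isolated_hull_def)
  then show ?thesis using assms by (auto simp: isolated_hull_def nat_pow_pow intro!: exI[of _ "m * l"])
qed

lemma (in comm_group) isolated_hull_least:
  assumes A: "A \<subseteq> carrier G" and B: "B \<subseteq> isolated_hull G A"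
  shows "isolated_hull G B \<subseteq> isolated_hull G A"
proof
  fix g assume "g \<in> isolated_hull G B"
  then obtain m :: nat where "m > 0" "g \<in> carrier G" "g [^] m \<in> generate G B" by (auto simp: isolated_hull_def)
  moreover have "generate G B \<subseteq> isolated_hull G A"
    by (rule generate_subgroup_incl[OF B subgroup_isolated_hull[OF A]])
  ultimately show "g \<in> isolated_hull G A" using isolated_hullI[OF A] by blast
qed

lemma (in comm_group) isolated_hull_mono:
  assumes "A \<subseteq> B" "B \<subseteq> carrier G"
  shows "isolated_hull G A \<subseteq> isolated_hull G B"
  using isolated_hull_superset[OF assms(2)] assms by (intro isolated_hull_least) auto

text \<open>
  The exchange axiom of a matroid: if \<open>g ^ m = a \<otimes> t ^ k\<close> with \<open>a\<close> generated by \<open>A\<close>, then \<open>k \<noteq> 0\<close>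
  because \<open>g\<close> is not in the hull of \<open>A\<close>, and solving for \<open>t ^ k\<close> puts \<open>t\<close> into the hull of \<open>insert g A\<close>.
\<close>

lemma (in comm_group) isolated_hull_exchange:
  assumes A: "A \<subseteq> carrier G" and t: "t \<in> carrier G"
    and g: "g \<in> isolated_hull G (insert t A)" and g': "g \<notin> isolated_hull G A"
  shows "t \<in> isolated_hull G (insert g A)"
proof -
  obtain m :: nat where m: "m > 0" "g \<in> carrier G" "g [^] m \<in> generate G (insert t A)"
    using g by (auto simp: isolated_hull_def)
  obtain a k where a: "a \<in> generate G A" and eq: "g [^] m = a \<otimes> t [^] (k::int)"
    using generate_insertD[OF A t m(3)] by blast
  have ac: "a \<in> carrier G" using a generate_in_carrier[OF A] by auto
  have "k \<noteq> 0"
  proof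
    assume "k = 0"
    then have "g [^] m \<in> generate G A" using a ac eq by simp
    then have "g \<in> isolated_hull G A" using m(1,2) unfolding isolated_hull_def by blast
    then show False using g' by simp
  qed
  have iA: "insert g A \<subseteq> carrier G" using A m by auto
  interpret S: subgroup "isolated_hull G (insert g A)" G by (rule subgroup_isolated_hull[OF iA])
  have gin: "g \<in> isolated_hull G (insert g A)" using isolated_hull_superset[OF iA] by auto
  have "a \<in> isolated_hull G (insert g A)"
    using generate_subgroup_incl[OF _ S.subgroup_axioms, of A] a isolated_hull_superset[OF iA] by blast
  then have "inv a \<in> isolated_hull G (insert g A)" by (rule S.m_inv_closed)
  moreover have gm: "g [^] m \<in> isolated_hull G (insert g A)"
    using gin by (induction m) auto
  moreover have "t [^] k = inv a \<otimes> g [^] m"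
    using ac t m unfolding eq by (simp add: m_assoc[symmetric])
  ultimately have tk: "t [^] k \<in> isolated_hull G (insert g A)" by simp
  have "t [^] nat \<bar>k\<bar> \<in> isolated_hull G (insert g A)"
  proof (cases "k \<ge> 0")
    case True
    then show ?thesis using tk by (simp flip: int_pow_int)
  next
    case False
    then have "t [^] nat \<bar>k\<bar> = inv (t [^] k)" using t by (simp add: int_pow_neg[symmetric] flip: int_pow_int)
    then show ?thesis using tk S.m_inv_closed by metis
  qed
  then show ?thesis using isolated_hullI[OF iA t, of "nat \<bar>k\<bar>"] \<open>k \<noteq> 0\<close> by simp
qed

text \<open>
  Independence over the integers, built up one element at a time.  This form avoids linear
  combinations: a proof about independent sets extends a smaller one by an element outside its hull.
\<close>

inductive independent_in :: "('a, 'b) monoid_scheme \<Rightarrow> 'a set \<Rightarrow> bool" for G where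
  empty: "independent_in G {}"
| insert: "independent_in G S \<Longrightarrow> g \<in> carrier G \<Longrightarrow> g \<notin> isolated_hull G S
            \<Longrightarrow> independent_in G (insert g S)"

lemma independent_in_finite: "independent_in G S \<Longrightarrow> finite S \<and> S \<subseteq> carrier G"
  by (induction rule: independent_in.induct) auto

text \<open>
  The rank is taken relative to the ambient group so that kernels and images need not be turned into
  groups of their own.  A relation is used since the rank may be infinite.
\<close>

definition has_rank :: "('a, 'b) monoid_scheme \<Rightarrow> 'a set \<Rightarrow> nat \<Rightarrow> bool" where
  "has_rank G A r \<longleftrightarrow> (\<exists>S\<subseteq>A. independent_in G S \<and> card S = r \<and> A \<subseteq> isolated_hull G S)"

text \<open>
  Adding the elements of \<open>T\<close> one after the other, consider the first \<open>t\<close> that brings \<open>g\<close> into the hull; the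
  exchange axiom applies to that \<open>t\<close>.
\<close>

lemma (in comm_group) isolated_hull_first_entry:
  assumes "finite T" "S \<subseteq> carrier G" "T \<subseteq> carrier G"
    "g \<notin> isolated_hull G S" "g \<in> isolated_hull G (S \<union> T)"
  shows "\<exists>t\<in>T. t \<in> isolated_hull G (insert g (S \<union> (T - {t})))"
  using assms
proof (induction T)
  case empty
  then show ?case by simp
next
  case (insert t T)
  have gc: "g \<in> carrier G" using insert.prems(4) by (simp add: isolated_hull_def)
  show ?case
  proof (cases "g \<in> isolated_hull G (S \<union> T)")
    case True
    then obtain u where u: "u \<in> T" "u \<in> isolated_hull G (insert g (S \<union> (T - {u})))"
      using insert by auto
    then have "u \<in> isolated_hull G (insert g (S \<union> (insert t T - {u})))"
      using isolated_hull_mono[of "insert g (S \<union> (T - {u}))" "insert g (S \<union> (insert t T - {u}))"]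
        gc insert.prems by blast
    then show ?thesis using u by blast
  next
    case False
    have "t \<in> isolated_hull G (insert g (S \<union> T))"
      using isolated_hull_exchange[of "S \<union> T" t g] False insert.prems by auto
    moreover have "insert t T - {t} = T" using insert by auto
    ultimately show ?thesis by auto
  qed
qed

text \<open>
  The Steinitz exchange lemma: the elements of \<open>S\<close> replace elements of \<open>T\<close> one at a time, and the hull
  does not shrink.
\<close>

lemma (in comm_group) independent_card_le:
  assumes S: "independent_in G S" and T: "finite T" "T \<subseteq> carrier G" and ST: "S \<subseteq> isolated_hull G T"
  shows "card S \<le> card T"
proof -
  have "\<exists>T'\<subseteq>T. card T' + card S = card T \<and> T \<subseteq> isolated_hull G (S \<union> T')"
    using S ST
  proof (induction rule: independent_in.induct)
    case empty
    then show ?case using isolated_hull_superset[OF T(2)] by auto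
  next
    case (insert S g)
    then obtain T' where T': "T' \<subseteq> T" "card T' + card S = card T" "T \<subseteq> isolated_hull G (S \<union> T')" by auto
    have Sf: "finite S" "S \<subseteq> carrier G" using independent_in_finite[OF insert.hyps(1)] by auto
    have c: "S \<union> T' \<subseteq> carrier G" using Sf T' T by auto
    have "g \<in> isolated_hull G (S \<union> T')"
      using isolated_hull_least[OF c T'(3)] insert.prems by auto
    then obtain t where t: "t \<in> T'" "t \<in> isolated_hull G (insert g (S \<union> (T' - {t})))"
      using isolated_hull_first_entry[of T' S g] Sf T' c insert.hyps finite_subset[OF T'(1) T(1)] by auto
    let ?B = "insert g (S \<union> (T' - {t}))"
    have cB: "?B \<subseteq> carrier G" using c insert.hyps by auto
    have "S \<union> T' \<subseteq> isolated_hull G ?B"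
      using isolated_hull_superset[OF cB] t by auto
    then have "T \<subseteq> isolated_hull G ?B" using isolated_hull_least[OF cB] T'(3) by blast
    moreover have "g \<notin> S" using insert.hyps isolated_hull_superset[OF Sf(2)] by auto
    moreover have "card (T' - {t}) + 1 = card T'"
      using t finite_subset[OF T'(1) T(1)] by (metis Suc_eq_plus1 card_Suc_Diff1)
    ultimately show ?case using T' Sf
      by (intro exI[of _ "T' - {t}"]) auto
  qed
  then show ?thesis by auto
qed

lemma (in comm_group) has_rank_unique:
  assumes "has_rank G A r" "has_rank G A s"
  shows "r = s"
proof -
  obtain S T where "S \<subseteq> A" "independent_in G S" "card S = r" "A \<subseteq> isolated_hull G S"
    "T \<subseteq> A" "independent_in G T" "card T = s" "A \<subseteq> isolated_hull G T"
    using assms unfolding has_rank_def by blast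
  then show ?thesis
    using independent_card_le[of S T] independent_card_le[of T S] independent_in_finite[of G S]
      independent_in_finite[of G T] by (meson le_antisym order_trans)
qed

text \<open>
  A largest independent subset of \<open>A\<close> exists by the bound \<open>card T\<close>, and it spans since it cannot be
  extended.
\<close>

lemma (in comm_group) has_rank_exists:
  assumes T: "finite T" "T \<subseteq> carrier G" and A: "A \<subseteq> isolated_hull G T"
  shows "\<exists>r. has_rank G A r"
proof -
  let ?P = "\<lambda>n. \<exists>S\<subseteq>A. independent_in G S \<and> card S = n"
  have "?P 0" by (intro exI[of _ "{}"]) (simp add: independent_in.empty)
  moreover have bound: "\<forall>n. ?P n \<longrightarrow> n \<le> card T" using independent_card_le[OF _ T] A by blast
  ultimately obtain n where n: "?P n" "\<And>k. ?P k \<Longrightarrow> k \<le> n"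
    using Nat.ex_has_greatest_nat[of ?P 0 "card T"] by blast
  then obtain S where S: "S \<subseteq> A" "independent_in G S" "card S = n" by blast
  have "A \<subseteq> isolated_hull G S"
  proof (rule ccontr)
    assume "\<not> ?thesis"
    then obtain g where g: "g \<in> A" "g \<notin> isolated_hull G S" by auto
    have "g \<in> carrier G" using g A by (auto simp: isolated_hull_def)
    then have "independent_in G (insert g S)" using S g by (intro independent_in.insert) auto
    moreover have "g \<notin> S" using g isolated_hull_superset independent_in_finite[OF S(2)] by auto
    ultimately have "?P (Suc n)"
      using S g independent_in_finite[OF S(2)] by (intro exI[of _ "insert g S"]) auto
    then show False using n(2) by force
  qed
  then show ?thesis using S unfolding has_rank_def by blast
qed

lemma (in comm_group) has_rank_subset_exists:
  assumes "has_rank G (carrier G) r" "A \<subseteq> carrier G"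
  shows "\<exists>s. has_rank G A s"
  using assms has_rank_exists independent_in_finite unfolding has_rank_def by (metis order_trans)

lemma hom_generate_image:
  assumes "group_hom G H f" "A \<subseteq> carrier G"
  shows "f ` generate G A = generate H (f ` A)"
  using group_hom.generate_img[OF assms(1) assms(2)] by simp

lemma rank_image_exists:
  assumes "comm_group G" "comm_group H" and f: "f \<in> hom G H" and r: "has_rank G (carrier G) r"
  shows "\<exists>s. has_rank H (f ` carrier G) s"
proof -
  interpret G: comm_group G by fact
  interpret H: comm_group H by fact
  interpret f: group_hom G H f by unfold_locales (rule f)
  obtain S where S: "finite S" "S \<subseteq> carrier G" "carrier G \<subseteq> isolated_hull G S"
    using r independent_in_finite unfolding has_rank_def by blast
  show ?thesis
  proof (rule H.has_rank_exists)
    show "finite (f ` S)" "f ` S \<subseteq> carrier H" using S by auto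
    show "f ` carrier G \<subseteq> isolated_hull H (f ` S)"
    proof clarify
      fix g assume g: "g \<in> carrier G"
      then obtain m :: nat where m: "m > 0" "g [^]\<^bsub>G\<^esub> m \<in> generate G S" using S by (auto simp: isolated_hull_def)
      then have "f (g [^]\<^bsub>G\<^esub> m) \<in> generate H (f ` S)"
        using hom_generate_image[OF f.group_hom_axioms S(2)] by blast
      then show "f g \<in> isolated_hull H (f ` S)" using m g by (auto simp: isolated_hull_def f.hom_nat_pow)
    qed
  qed
qed

text \<open>
  Independent elements of the image are lifted one at a time and added to a basis of the kernel.
\<close>

theorem rank_nullity:
  assumes "comm_group G" "comm_group H" and f: "f \<in> hom G H"
    and a: "has_rank G (kernel G H f) a" and b: "has_rank H (f ` carrier G) b"
  shows "has_rank G (carrier G) (a + b)"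
proof -
  interpret G: comm_group G by fact
  interpret H: comm_group H by fact
  interpret f: group_hom G H f by unfold_locales (rule f)
  obtain S where S: "S \<subseteq> kernel G H f" "independent_in G S" "card S = a" "kernel G H f \<subseteq> isolated_hull G S"
    using a unfolding has_rank_def by blast
  obtain T where T: "T \<subseteq> f ` carrier G" "independent_in H T" "card T = b" "f ` carrier G \<subseteq> isolated_hull H T"
    using b unfolding has_rank_def by blast
  have Sf: "finite S" "S \<subseteq> carrier G" using independent_in_finite[OF S(2)] by auto
  have "\<exists>U\<subseteq>carrier G. f ` U = T \<and> independent_in G (S \<union> U) \<and> card (S \<union> U) = card S + card T"
    using T(2,1)
  proof (induction rule: independent_in.induct)
    case empty
    then show ?case using S by auto
  next
    case (insert T g)
    then obtain U where U: "U \<subseteq> carrier G" "f ` U = T" "independent_in G (S \<union> U)" "card (S \<union> U) = card S + card T"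
      by auto
    obtain x where x: "x \<in> carrier G" "g = f x" using insert.prems by auto
    have Tc: "T \<subseteq> carrier H" "finite T" using independent_in_finite[OF insert.hyps(1)] by auto
    have SU: "finite (S \<union> U)" "S \<union> U \<subseteq> carrier G" using independent_in_finite[OF U(3)] by auto
    have xn: "x \<notin> isolated_hull G (S \<union> U)"
    proof
      assume "x \<in> isolated_hull G (S \<union> U)"
      then obtain m :: nat where m: "m > 0" "x [^]\<^bsub>G\<^esub> m \<in> generate G (S \<union> U)" by (auto simp: isolated_hull_def)
      then have "f (x [^]\<^bsub>G\<^esub> m) \<in> generate H (f ` (S \<union> U))"
        using hom_generate_image[OF f.group_hom_axioms SU(2)] by blast
      moreover have "f ` (S \<union> U) \<subseteq> generate H T"
        using S(1) U(2) generate.one[of H T] by (auto simp: kernel_def intro: generate.incl)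
      then have "generate H (f ` (S \<union> U)) \<subseteq> generate H T"
        using H.generate_subgroup_incl H.generate_is_subgroup[OF Tc(1)] by blast
      ultimately have "g \<in> isolated_hull H T" using m x by (auto simp: isolated_hull_def f.hom_nat_pow)
      then show False using insert.hyps by auto
    qed
    then have "independent_in G (insert x (S \<union> U))" using U x by (intro independent_in.insert) auto
    moreover have "x \<notin> S \<union> U" using xn G.isolated_hull_superset[OF SU(2)] by auto
    moreover have "g \<notin> T" using insert.hyps H.isolated_hull_superset[OF Tc(1)] by auto
    ultimately show ?case using U x SU Tc by (intro exI[of _ "insert x U"]) auto
  qed
  then obtain U where U: "U \<subseteq> carrier G" "f ` U = T" "independent_in G (S \<union> U)" "card (S \<union> U) = card S + card T"
    by blast
  have SU: "finite (S \<union> U)" "S \<union> U \<subseteq> carrier G" using independent_in_finite[OF U(3)] by auto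
  interpret I: subgroup "isolated_hull G (S \<union> U)" G by (rule G.subgroup_isolated_hull[OF SU(2)])
  have "carrier G \<subseteq> isolated_hull G (S \<union> U)"
  proof
    fix g assume g: "g \<in> carrier G"
    then have "f g \<in> isolated_hull H T" using T by auto
    then obtain m :: nat where m: "m > 0" "f g [^]\<^bsub>H\<^esub> m \<in> generate H T" unfolding isolated_hull_def by blast
    then obtain u where u: "u \<in> generate G U" "f (g [^]\<^bsub>G\<^esub> m) = f u"
      using hom_generate_image[OF f.group_hom_axioms U(1)] U(2) g by (auto simp: f.hom_nat_pow)
    have uc: "u \<in> carrier G" using G.generate_in_carrier[OF U(1) u(1)] .
    have uh: "u \<in> isolated_hull G (S \<union> U)"
      using u G.generate_subgroup_incl[OF _ I.subgroup_axioms, of U] G.isolated_hull_superset[OF SU(2)] by blast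
    have "g [^]\<^bsub>G\<^esub> m \<otimes>\<^bsub>G\<^esub> inv\<^bsub>G\<^esub> u \<in> kernel G H f"
      using u uc g by (simp add: kernel_def)
    then have "g [^]\<^bsub>G\<^esub> m \<otimes>\<^bsub>G\<^esub> inv\<^bsub>G\<^esub> u \<in> isolated_hull G (S \<union> U)"
      using S(4) G.isolated_hull_mono[of S "S \<union> U"] SU by blast
    then have "(g [^]\<^bsub>G\<^esub> m \<otimes>\<^bsub>G\<^esub> inv\<^bsub>G\<^esub> u) \<otimes>\<^bsub>G\<^esub> u \<in> isolated_hull G (S \<union> U)"
      using uh by (rule I.m_closed)
    then have "g [^]\<^bsub>G\<^esub> m \<in> isolated_hull G (S \<union> U)" using g uc by (simp add: G.m_assoc)
    then show "g \<in> isolated_hull G (S \<union> U)" using G.isolated_hullI[OF SU(2) g m(1)] by blast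
  qed
  then show ?thesis using U SU S T unfolding has_rank_def by (intro exI[of _ "S \<union> U"]) auto
qed

lemma has_rank_trivial:
  assumes "group G"
  shows "has_rank G {\<one>\<^bsub>G\<^esub>} 0"
proof -
  interpret group G by fact
  have "\<one>\<^bsub>G\<^esub> \<in> isolated_hull G {}"
    by (auto simp: isolated_hull_def intro!: exI[of _ "1::nat"] generate.one)
  then show ?thesis unfolding has_rank_def using independent_in.empty
    by (intro exI[of _ "{}"]) auto
qed

lemma has_rank_iso:
  assumes G: "comm_group G" and H: "comm_group H" and "G \<cong> H" "has_rank G (carrier G) r"
  shows "has_rank H (carrier H) r"
proof -
  interpret G: comm_group G by fact
  interpret H: comm_group H by fact
  obtain f where "f \<in> iso G H" using assms by (auto simp: is_iso_def)
  then have f: "f \<in> hom G H" "inj_on f (carrier G)" "f ` carrier G = carrier H"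
    by (auto simp: iso_iff Group.iso_def bij_betw_def)
  interpret f: group_hom G H f by unfold_locales (rule f)
  obtain s where s: "has_rank H (carrier H) s" using rank_image_exists[OF G H f(1) assms(4)] f by auto
  have k: "kernel G H f = {\<one>\<^bsub>G\<^esub>}" using f.inj_iff_trivial_ker f(2) by auto
  have "has_rank G (kernel G H f) 0" unfolding k by (rule has_rank_trivial) (rule G.is_group)
  then have "has_rank G (carrier G) (0 + s)"
    using rank_nullity[OF G H f(1), of 0 s] s f(3) by simp
  then show ?thesis using G.has_rank_unique[OF assms(4)] s by simp
qed

lemma has_rank_integer_group: "has_rank integer_group (carrier integer_group) 1"
proof -
  interpret comm_group integer_group by (rule abelian_integer_group)
  have "1 \<notin> isolated_hull integer_group {}"
    unfolding isolated_hull_def generate_empty by simp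
  then have "independent_in integer_group {1}"
    using independent_in.insert[OF independent_in.empty, where G = integer_group and g = 1] by simp
  moreover have "x \<in> isolated_hull integer_group {1}" for x
  proof -
    have "generate integer_group {1} = UNIV"
      using generate_pow[of 1] by auto
    then show ?thesis unfolding isolated_hull_def by (simp add: exI[of _ "1::nat"])
  qed
  ultimately show ?thesis unfolding has_rank_def by (intro exI[of _ "{1}"]) auto
qed


section \<open>Euler characteristics from homology\<close>

definition relative_betti :: "int \<Rightarrow> 'a topology \<Rightarrow> 'a set \<Rightarrow> nat \<Rightarrow> bool" where
  "relative_betti p X S r \<longleftrightarrow>
     has_rank (relative_homology_group p X S) (carrier (relative_homology_group p X S)) r"

lemma relative_betti_unique:
  "relative_betti p X S r \<Longrightarrow> relative_betti p X S s \<Longrightarrow> r = s"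
  unfolding relative_betti_def
  by (rule comm_group.has_rank_unique[OF abelian_relative_homology_group])

lemma relative_betti_iso:
  assumes "relative_homology_group p X S \<cong> relative_homology_group q Y T" "relative_betti p X S r"
  shows "relative_betti q Y T r"
  using assms has_rank_iso[OF abelian_relative_homology_group abelian_relative_homology_group]
  unfolding relative_betti_def by blast

lemma relative_betti_trivial:
  assumes "trivial_group (relative_homology_group p X S)"
  shows "relative_betti p X S 0"
  using has_rank_trivial[OF group_relative_homology_group[of p X S]] assms
  unfolding relative_betti_def trivial_group_def by simp

text \<open>
  Here \<open>i\<close>, \<open>j\<close> and \<open>d\<close> are the ranks of the images of the three kinds of maps in the long exact
  sequence of the pair; exactness identifies each image with the next kernel, and rank-nullity does
  the rest.
\<close>

lemma relative_betti_exact_step: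
  assumes "\<And>p. relative_betti p (subtopology X S) {} (a p)" "\<And>p. relative_betti p X S (r p)"
  shows "\<exists>d i j. \<forall>p. a p = d (p + 1) + i p \<and> r p = j p + d p \<and> relative_betti p X {} (i p + j p)"
proof -
  let ?A = "\<lambda>p. homology_group p (subtopology X S)"
  let ?X = "\<lambda>p. homology_group p X"
  let ?R = "\<lambda>p. relative_homology_group p X S"
  let ?f = "\<lambda>p. hom_induced p (subtopology X S) {} X {} id"
  let ?g = "\<lambda>p. hom_induced p X {} X S id"
  let ?h = "\<lambda>p. hom_boundary p X S"
  have f: "?f p \<in> hom (?A p) (?X p)" and g: "?g p \<in> hom (?X p) (?R p)"
    and h: "?h p \<in> hom (?R p) (?A (p - 1))" for p
    by (auto intro: hom_induced_hom hom_boundary_hom)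
  have ex_g: "kernel (?X p) (?R p) (?g p) = ?f p ` carrier (?A p)" for p
    using homology_exactness_axiom_3[of p X S] by simp
  have ex_h: "kernel (?R p) (?A (p - 1)) (?h p) = ?g p ` carrier (?X p)" for p
    using homology_exactness_axiom_1[of p X S] by simp
  have ex_f: "kernel (?A (p - 1)) (?X (p - 1)) (?f (p - 1)) = ?h p ` carrier (?R p)" for p
    using homology_exactness_axiom_2[of p X S] by simp
  note ab = abelian_relative_homology_group
  have "\<exists>s. has_rank (?A (p - 1)) (?h p ` carrier (?R p)) s" for p
    using rank_image_exists[OF ab ab h] assms(2) unfolding relative_betti_def by blast
  then obtain d where d: "\<And>p. has_rank (?A (p - 1)) (?h p ` carrier (?R p)) (d p)" by metis
  have "\<exists>s. has_rank (?X p) (?f p ` carrier (?A p)) s" for p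
    using rank_image_exists[OF ab ab f] assms(1) unfolding relative_betti_def by blast
  then obtain i where i: "\<And>p. has_rank (?X p) (?f p ` carrier (?A p)) (i p)" by metis
  have "\<exists>s. has_rank (?R p) (?g p ` carrier (?X p)) s" for p
    using comm_group.has_rank_subset_exists[OF ab, of p X S "r p" "?g p ` carrier (?X p)"]
      assms(2) hom_carrier[OF g] unfolding relative_betti_def by blast
  then obtain j where j: "\<And>p. has_rank (?R p) (?g p ` carrier (?X p)) (j p)" by metis
  have "has_rank (?A p) (carrier (?A p)) (d (p + 1) + i p)" for p
  proof (rule rank_nullity[OF ab ab f _ i])
    show "has_rank (?A p) (kernel (?A p) (?X p) (?f p)) (d (p + 1))"
      using d[of "p + 1"] ex_f[of "p + 1"] by simp
  qed
  then have "relative_betti p (subtopology X S) {} (d (p + 1) + i p)" for p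
    unfolding relative_betti_def .
  moreover have "has_rank (?R p) (carrier (?R p)) (j p + d p)" for p
    using rank_nullity[OF ab ab h, of p "j p" "d p"] d[of p] j[of p] ex_h[of p] by simp
  then have "relative_betti p X S (j p + d p)" for p
    unfolding relative_betti_def .
  moreover have "has_rank (?X p) (carrier (?X p)) (i p + j p)" for p
    using rank_nullity[OF ab ab g, of p "i p" "j p"] i[of p] j[of p] ex_g[of p] by simp
  then have "relative_betti p X {} (i p + j p)" for p
    unfolding relative_betti_def .
  ultimately show ?thesis
    using relative_betti_unique assms by blast
qed

text \<open>
  The bound \<open>N\<close> makes the alternating sum finite; that the ranks are finite is part of the predicate.
\<close>

definition has_euler_char :: "'a topology \<Rightarrow> int \<Rightarrow> bool" where
  "has_euler_char X c \<longleftrightarrow>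
     (\<exists>b N. (\<forall>p. relative_betti p X {} (b p)) \<and> (\<forall>p. p < 0 \<or> p > int N \<longrightarrow> b p = 0) \<and>
        c = (\<Sum>p\<le>N. (-1) ^ p * int (b (int p))))"

lemma alternating_sum_extend:
  fixes b :: "int \<Rightarrow> nat"
  assumes "\<forall>p. p < 0 \<or> p > int N \<longrightarrow> b p = 0" "N \<le> M"
  shows "(\<Sum>p\<le>M. (-1) ^ p * int (b (int p))) = (\<Sum>p\<le>N. (-1) ^ p * int (b (int p)))"
  by (rule sum.mono_neutral_right) (use assms in auto)

lemma has_euler_char_unique:
  assumes "has_euler_char X c" "has_euler_char X d"
  shows "c = d"
proof -
  obtain b N where b: "\<forall>p. relative_betti p X {} (b p)" "\<forall>p. p < 0 \<or> p > int N \<longrightarrow> b p = 0"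
    "c = (\<Sum>p\<le>N. (-1) ^ p * int (b (int p)))"
    using assms(1) unfolding has_euler_char_def by blast
  obtain b' N' where b': "\<forall>p. relative_betti p X {} (b' p)" "\<forall>p. p < 0 \<or> p > int N' \<longrightarrow> b' p = 0"
    "d = (\<Sum>p\<le>N'. (-1) ^ p * int (b' (int p)))"
    using assms(2) unfolding has_euler_char_def by blast
  have "b = b'" using b(1) b'(1) relative_betti_unique by blast
  then show ?thesis
    using b b' alternating_sum_extend[of N b "max N N'"] alternating_sum_extend[of N' b "max N N'"] by simp
qed

lemma has_euler_char_iso:
  assumes "\<And>p. homology_group p X \<cong> homology_group p Y" "has_euler_char X c"
  shows "has_euler_char Y c"
proof -
  obtain b N where "\<forall>p. relative_betti p X {} (b p)" "\<forall>p. p < 0 \<or> p > int N \<longrightarrow> b p = 0"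
    "c = (\<Sum>p\<le>N. (-1) ^ p * int (b (int p)))"
    using assms(2) unfolding has_euler_char_def by blast
  then show ?thesis unfolding has_euler_char_def
    by (intro exI[of _ b] exI[of _ N]) (auto intro: relative_betti_iso[OF assms(1)])
qed

lemma has_euler_char_empty:
  assumes "topspace X = {}"
  shows "has_euler_char X 0"
proof -
  have "relative_betti p X {} 0" for p
    by (rule relative_betti_trivial[OF trivial_homology_group_empty[OF assms]])
  then show ?thesis unfolding has_euler_char_def by (intro exI[of _ "\<lambda>_. 0"] exI[of _ 0]) auto
qed

lemma telescoping_alternating_sum:
  fixes d :: "int \<Rightarrow> nat"
  shows "(\<Sum>p\<le>M. (-1) ^ p * (int (d (int p + 1)) + int (d (int p)))) = int (d 0) + (-1) ^ M * int (d (int M + 1))"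
  by (induction M) (auto simp: algebra_simps)

text \<open>
  If all relative homology is one copy of rank one in degree \<open>k\<close>, the ranks of the connecting maps
  occur twice in the alternating sum, with opposite signs, and only the relative group contributes.
\<close>

theorem has_euler_char_add_cell:
  assumes A: "has_euler_char (subtopology X S) c"
    and R: "\<And>p. relative_betti p X S (if p = int k then 1 else 0)"
  shows "has_euler_char X (c + (-1) ^ k)"
proof -
  obtain a N where a: "\<forall>p. relative_betti p (subtopology X S) {} (a p)"
      "\<forall>p. p < 0 \<or> p > int N \<longrightarrow> a p = 0" "c = (\<Sum>p\<le>N. (-1) ^ p * int (a (int p)))"
    using A unfolding has_euler_char_def by blast
  define r where "r p = (if p = int k then 1 else 0 :: nat)" for p
  have r: "relative_betti p X S (r p)" for p using R[of p] by (simp add: r_def)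
  obtain d i j where dij: "\<And>p. a p = d (p + 1) + i p" "\<And>p. r p = j p + d p"
      "\<And>p. relative_betti p X {} (i p + j p)"
    using relative_betti_exact_step[OF spec[OF a(1)] r] by metis
  define M where "M = max N k"
  have r0: "\<forall>p. p < 0 \<or> p > int k \<longrightarrow> r p = 0" by (auto simp: r_def)
  \<comment> \<open>The outermost connecting ranks vanish because the groups around them do.\<close>
  have d0: "d 0 = 0" using dij(1)[of "-1"] a(2) by simp
  have dM: "d (int M + 1) = 0" using dij(2)[of "int M + 1"] r0 by (simp add: M_def)
  have "(\<Sum>p\<le>M. (-1) ^ p * int (i (int p) + j (int p)))
      = (\<Sum>p\<le>M. (-1) ^ p * int (a (int p)) + (-1) ^ p * int (r (int p))
            - (-1) ^ p * (int (d (int p + 1)) + int (d (int p))))"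
    by (rule sum.cong) (simp_all add: dij(1,2) algebra_simps)
  also have "\<dots> = (\<Sum>p\<le>M. (-1) ^ p * int (a (int p))) + (\<Sum>p\<le>M. (-1) ^ p * int (r (int p)))"
    unfolding sum_subtractf sum.distrib telescoping_alternating_sum d0 dM by simp
  also have "(\<Sum>p\<le>M. (-1) ^ p * int (a (int p))) = c"
    using alternating_sum_extend[OF a(2), of M] a(3) by (simp add: M_def)
  also have "(\<Sum>p\<le>M. (-1) ^ p * int (r (int p))) = (\<Sum>p\<le>M. if p = k then (-1) ^ k else 0)"
    by (rule sum.cong) (auto simp: r_def)
  also have "\<dots> = (-1) ^ k" by (simp add: M_def)
  finally have "c + (-1) ^ k = (\<Sum>p\<le>M. (-1) ^ p * int (i (int p) + j (int p)))" by simp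
  moreover have "i p + j p = 0" if "p < 0 \<or> p > int M" for p
  proof -
    have "a p = 0" "r p = 0" using that a(2) r0 by (auto simp: M_def)
    then show ?thesis using dij(1,2)[of p] by simp
  qed
  ultimately show ?thesis using dij(3) unfolding has_euler_char_def
    by (intro exI[of _ "\<lambda>p. i p + j p"] exI[of _ M]) auto
qed

text \<open>
  The claim does not depend on the position of \<open>z\<close>, and for the origin, raising the dimension by one shifts
  the degree by one, which reduces it to the homology of a single point.
\<close>

lemma relative_betti_Euclidean_point:
  assumes z: "z \<in> topspace (Euclidean_space n)"
  shows "relative_betti p (Euclidean_space n) (topspace (Euclidean_space n) - {z}) (if p = int n then 1 else 0)"
proof -
  let ?o = "\<lambda>i::nat. 0::real"
  have o: "?o \<in> topspace (Euclidean_space m)" for m by (simp add: topspace_Euclidean_space)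
  have cl: "closedin (Euclidean_space m) {y}" if "y \<in> topspace (Euclidean_space m)" for y m
    using that by (simp add: closedin_Hausdorff_sing_eq Hausdorff_Euclidean_space)
  have "relative_homology_group (p - int n) (Euclidean_space 0) (topspace (Euclidean_space 0) - {?o})
      \<cong> relative_homology_group (p - int n + int n) (Euclidean_space (0 + n)) (topspace (Euclidean_space (0 + n)) - {?o})"
    by (rule relative_homology_group_Euclidean_complement_step[OF cl[OF o]])
  moreover have t0: "topspace (Euclidean_space 0) = {?o}" by (auto simp: topspace_Euclidean_space)
  ultimately have 1: "homology_group (p - int n) (Euclidean_space 0)
      \<cong> relative_homology_group p (Euclidean_space n) (topspace (Euclidean_space n) - {?o})" by simp
  have "relative_homology_group p (Euclidean_space n) (topspace (Euclidean_space n) - {?o})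
      \<cong> relative_homology_group p (Euclidean_space n) (topspace (Euclidean_space n) - {z})"
  proof (rule isomorphic_relative_homology_groups_Euclidean_complements[OF cl[OF o] cl[OF z]])
    show "subtopology (Euclidean_space n) {?o} homeomorphic_space subtopology (Euclidean_space n) {z}"
      unfolding homeomorphic_space_def homeomorphic_maps_def using o z
      by (intro exI[of _ "\<lambda>_. z"] exI[of _ "\<lambda>_. ?o"]) (auto simp: continuous_map_in_subtopology)
  qed
  note iso = iso_trans[OF 1 this]
  have "relative_betti (p - int n) (Euclidean_space 0) {} (if p = int n then 1 else 0)"
  proof (cases "p = int n")
    case True
    have "integer_group \<cong> homology_group 0 (Euclidean_space 0)"
      by (rule group.iso_sym[OF group_relative_homology_group homology_coefficients[OF t0]])
    then show ?thesis using True has_rank_iso[OF abelian_integer_group abelian_relative_homology_group _ has_rank_integer_group]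
      by (simp add: relative_betti_def)
  next
    case False
    then show ?thesis by (simp add: relative_betti_trivial homology_dimension_axiom[OF t0])
  qed
  then show ?thesis by (rule relative_betti_iso[OF iso])
qed

text \<open>
  Excision of the complement of \<open>U\<close> makes the relative homology depend on \<open>U\<close> alone.
\<close>

theorem local_betti_at_Euclidean_point:
  assumes X: "Hausdorff_space X" and U: "openin X U" and x: "x \<in> U"
    and hom: "subtopology X U homeomorphic_space Euclidean_space n"
  shows "relative_betti p X (topspace X - {x}) (if p = int n then 1 else 0)"
proof -
  have UX: "U \<subseteq> topspace X" using U by (rule openin_subset)
  have xX: "x \<in> topspace X" using x UX by blast
  let ?T = "topspace X - {x}" and ?C = "topspace X - U"
  have "X closure_of ?C = ?C" using U by (simp add: closure_of_eq closedin_diff)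
  moreover have "closedin X {x}" using X xX by (simp add: closedin_Hausdorff_sing_eq)
  then have "openin X ?T" by blast
  then have "X interior_of ?T = ?T" by (simp add: interior_of_eq)
  ultimately have "X closure_of ?C \<subseteq> X interior_of ?T" using x by auto
  from homology_excision_axiom[OF this Diff_subset, of p]
  have "relative_homology_group p (subtopology X (topspace X - ?C)) (?T - ?C) \<cong>
        relative_homology_group p (subtopology X (topspace X)) ?T"
    by (rule is_isoI)
  moreover have "topspace X - ?C = U" "?T - ?C = U - {x}" using UX by auto
  ultimately have exc: "relative_homology_group p (subtopology X U) (U - {x}) \<cong> relative_homology_group p X ?T"
    by simp
  obtain f where f: "homeomorphic_map (subtopology X U) (Euclidean_space n) f"
    using hom by (auto simp: homeomorphic_space)
  have tU: "topspace (subtopology X U) = U" using UX by auto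
  have im: "f ` U = topspace (Euclidean_space n)" and inj: "inj_on f U"
    using f homeomorphic_imp_surjective_map[OF f] homeomorphic_imp_injective_map[OF f] tU by auto
  have "f ` (U - {x}) = topspace (Euclidean_space n) - {f x}"
    using im inj x by (simp add: inj_on_image_set_diff[OF inj])
  from homeomorphic_map_relative_homology_iso[OF f _ this, of p]
  have "relative_homology_group p (subtopology X U) (U - {x})
      \<cong> relative_homology_group p (Euclidean_space n) (topspace (Euclidean_space n) - {f x})"
    using tU by (intro is_isoI) auto
  then have "relative_homology_group p (Euclidean_space n) (topspace (Euclidean_space n) - {f x}) \<cong>
      relative_homology_group p (subtopology X U) (U - {x})"
    by (rule group.iso_sym[OF group_relative_homology_group])
  then have "relative_homology_group p (Euclidean_space n) (topspace (Euclidean_space n) - {f x}) \<cong>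
      relative_homology_group p X ?T" using exc by (rule iso_trans)
  then show ?thesis
    by (rule relative_betti_iso) (rule relative_betti_Euclidean_point, use im x in auto)
qed


section \<open>Simplices and punctured complexes\<close>

text \<open>
  For a simplex given as a point set this recovers the affinely independent set that spans it.
\<close>

definition vertices :: "'a::euclidean_space set \<Rightarrow> 'a set" where
  "vertices \<sigma> = {v. v extreme_point_of \<sigma>}"

lemma vertices_convex_hull: "\<not> affine_dependent C \<Longrightarrow> vertices (convex hull C) = C"
  by (simp add: vertices_def extreme_point_of_convex_hull_affine_independent)

lemma simplex_vertices:
  assumes "n simplex \<sigma>"
  shows "\<not> affine_dependent (vertices \<sigma>)" "finite (vertices \<sigma>)"
    "int (card (vertices \<sigma>)) = n + 1" "convex hull (vertices \<sigma>) = \<sigma>"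
  using assms unfolding simplex by (auto simp: vertices_convex_hull)

lemma complex_vertices:
  assumes "simplicial_complex K" "\<sigma> \<in> K"
  shows "\<not> affine_dependent (vertices \<sigma>)" "finite (vertices \<sigma>)" "convex hull (vertices \<sigma>) = \<sigma>"
  using assms simplex_vertices unfolding simplicial_complex_def by blast+

lemma complex_hull_face:
  assumes "simplicial_complex K" "\<sigma> \<in> K" "U \<subseteq> vertices \<sigma>"
  shows "convex hull U \<in> K" "vertices (convex hull U) = U" "convex hull U face_of \<sigma>"
proof -
  have i: "\<not> affine_dependent (vertices \<sigma>)" by (rule complex_vertices[OF assms(1,2)])
  have "convex hull U face_of convex hull (vertices \<sigma>)"
    using face_of_convex_hull_affine_independent[OF i] assms(3) by blast
  then show f: "convex hull U face_of \<sigma>" using complex_vertices[OF assms(1,2)] by simp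
  then show "convex hull U \<in> K" using assms unfolding simplicial_complex_def by blast
  show "vertices (convex hull U) = U"
    using affine_dependent_subset[OF _ assms(3)] i by (intro vertices_convex_hull) blast
qed

lemma complex_subset_iff:
  assumes K: "simplicial_complex K" and s: "\<sigma> \<in> K" and t: "\<tau> \<in> K"
  shows "\<sigma> \<subseteq> \<tau> \<longleftrightarrow> vertices \<sigma> \<subseteq> vertices \<tau>"
proof
  assume "\<sigma> \<subseteq> \<tau>"
  then have "\<tau> \<inter> \<sigma> = \<sigma>" by blast
  moreover have "(\<tau> \<inter> \<sigma>) face_of \<tau>" using K s t unfolding simplicial_complex_def by blast
  ultimately have "\<sigma> face_of convex hull (vertices \<tau>)" using complex_vertices[OF K t] by simp
  then obtain U where "U \<subseteq> vertices \<tau>" "\<sigma> = convex hull U"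
    using face_of_convex_hull_affine_independent complex_vertices(1)[OF K t] by blast
  then show "vertices \<sigma> \<subseteq> vertices \<tau>" using complex_hull_face[OF K t] by simp
next
  assume "vertices \<sigma> \<subseteq> vertices \<tau>"
  then show "\<sigma> \<subseteq> \<tau>" using hull_mono complex_vertices(3)[OF K] s t by metis
qed

text \<open>
  A point in the relative interior of a simplex lies on no proper face, so it tells which simplices of
  the complex contain that simplex.  All passages between point sets and vertex sets use such points.
\<close>

lemma rel_interior_mem_iff:
  assumes K: "simplicial_complex K" and s: "\<sigma> \<in> K" and t: "\<tau> \<in> K" and x: "x \<in> rel_interior \<sigma>"
  shows "x \<in> \<tau> \<longleftrightarrow> \<sigma> \<subseteq> \<tau>"
proof
  assume "x \<in> \<tau>"
  have "(\<sigma> \<inter> \<tau>) face_of \<sigma>" using K s t unfolding simplicial_complex_def by blast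
  moreover have "x \<in> (\<sigma> \<inter> \<tau>) \<inter> rel_interior \<sigma>" using x \<open>x \<in> \<tau>\<close> rel_interior_subset by blast
  ultimately have "\<sigma> \<inter> \<tau> = \<sigma>" using face_of_disjoint_rel_interior by blast
  then show "\<sigma> \<subseteq> \<tau>" by blast
qed (use x rel_interior_subset in blast)

text \<open>
  Affine functions with prescribed values at affinely independent points are linear functions of the
  differences from one of these points.  Taking the value \<open>-1\<close> at the differences from \<open>v\<close> makes
  \<open>1 + g (y - v)\<close> equal to \<open>1\<close> at \<open>v\<close> and to \<open>0\<close> at the others.
\<close>

lemma barycentric_coordinate:
  fixes C :: "'a::euclidean_space set"
  assumes C: "\<not> affine_dependent C" and v: "v \<in> C"
  shows "\<exists>\<phi> :: 'a \<Rightarrow> real. continuous_on UNIV \<phi> \<and>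
    (\<forall>u. sum u C = 1 \<longrightarrow> \<phi> (\<Sum>w\<in>C. u w *\<^sub>R w) = u v)"
proof -
  have fin: "finite C" using C aff_independent_finite by blast
  have "independent ((\<lambda>x. - v + x) ` (C - {v}))"
    using C affine_dependent_iff_dependent2[OF v] by blast
  from linear_independent_extend[OF this, of "\<lambda>_. -1 :: real"]
  obtain g where g: "linear g" "\<forall>x\<in>(\<lambda>x. - v + x) ` (C - {v}). g x = (-1 :: real)" by blast
  interpret g: linear g by (rule g(1))
  show ?thesis
  proof (intro exI[of _ "\<lambda>y. 1 + g (y - v)"] conjI allI impI)
    show "continuous_on UNIV (\<lambda>y. 1 + g (y - v))"
      by (intro continuous_intros linear_continuous_on_compose[OF _ g(1)])
  next
    fix u :: "'a \<Rightarrow> real" assume u: "sum u C = 1"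
    have "(\<Sum>w\<in>C. u w *\<^sub>R w) - v = (\<Sum>w\<in>C. u w *\<^sub>R (w - v))"
      using u by (simp add: scaleR_diff_right sum_subtractf flip: scaleR_sum_left)
    then have "g ((\<Sum>w\<in>C. u w *\<^sub>R w) - v) = (\<Sum>w\<in>C. u w * g (w - v))"
      by (simp add: g.sum g.scaleR)
    also have "\<dots> = (\<Sum>w\<in>C. u w * (if w = v then 0 else -1))"
      using g(2) by (intro sum.cong) (auto simp: g.zero)
    also have "\<dots> = (\<Sum>w\<in>C. (if w = v then u w else 0) - u w)" by (rule sum.cong) auto
    also have "\<dots> = u v - 1" using fin v u by (simp add: sum_subtractf)
    finally show "1 + g ((\<Sum>w\<in>C. u w *\<^sub>R w) - v) = u v" by simp
  qed
qed

lemma continuous_on_Min_image: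
  fixes f :: "'i \<Rightarrow> 'a::topological_space \<Rightarrow> real"
  assumes "finite I" "I \<noteq> {}" "\<And>i. i \<in> I \<Longrightarrow> continuous_on S (f i)"
  shows "continuous_on S (\<lambda>x. Min ((\<lambda>i. f i x) ` I))"
  using assms
proof (induction I rule: finite_ne_induct)
  case (insert i I)
  then have "continuous_on S (\<lambda>x. min (f i x) (Min ((\<lambda>i. f i x) ` I)))"
    by (intro continuous_on_min) auto
  then show ?case using insert by simp
qed simp

text \<open>
  Each point \<open>y \<noteq> x\<close> is pushed away from \<open>x\<close> until it leaves the star of \<open>\<sigma>\<close>.  In a simplex that contains
  \<open>\<sigma>\<close>, with barycentric coordinates \<open>u\<close> of \<open>y\<close> and \<open>a\<close> of \<open>x\<close>, subtracting \<open>q\<close> times \<open>a\<close> from \<open>u\<close> keeps all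
  coordinates non-negative up to \<open>q = Min (u v / a v)\<close>, the minimum being over the vertices \<open>v\<close> of \<open>\<sigma>\<close>; there
  a coordinate of \<open>\<sigma>\<close> vanishes, and normalising gives the point \<open>x + (y - x) / (1 - q)\<close>.
\<close>

theorem punctured_complex_retraction:
  fixes K :: "'a::euclidean_space set set"
  assumes K: "simplicial_complex K" and s: "\<sigma> \<in> K" and x: "x \<in> rel_interior \<sigma>"
  obtains r where "continuous_on (\<Union>K - {x}) r"
    "\<And>y. y \<in> \<Union>K - {x} \<Longrightarrow> r y \<in> \<Union>{\<tau>\<in>K. x \<notin> \<tau>}"
    "\<And>y. y \<in> \<Union>{\<tau>\<in>K. x \<notin> \<tau>} \<Longrightarrow> r y = y"
    "\<And>y. y \<in> \<Union>K - {x} \<Longrightarrow> closed_segment (r y) y \<subseteq> \<Union>K - {x}"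
proof -
  let ?C = "vertices \<sigma>"
  note Cs = complex_vertices[OF K s]
  have xs: "x \<in> \<sigma>" using x rel_interior_subset by blast
  have Cne: "?C \<noteq> {}" using xs Cs(3) by auto
  obtain a0 where a0: "\<forall>v\<in>?C. 0 < a0 v" "sum a0 ?C = 1" "(\<Sum>v\<in>?C. a0 v *\<^sub>R v) = x"
    using x rel_interior_convex_hull_explicit[OF Cs(1)] Cs(3) by auto
  define a where "a v = (if v \<in> ?C then a0 v else 0)" for v
  have a_pos: "v \<in> ?C \<Longrightarrow> 0 < a v" for v using a0 by (simp add: a_def)
  have a_nonneg: "0 \<le> a v" for v using a0 by (auto simp: a_def less_imp_le)
  have a_sum: "sum a D = 1" and a_x: "(\<Sum>v\<in>D. a v *\<^sub>R v) = x" if "finite D" "?C \<subseteq> D" for D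
  proof -
    have "sum a D = sum a0 ?C"
      using that by (intro sum.mono_neutral_cong_right) (auto simp: a_def)
    then show "sum a D = 1" using a0 by simp
    have "(\<Sum>v\<in>D. a v *\<^sub>R v) = (\<Sum>v\<in>?C. a0 v *\<^sub>R v)"
      using that by (intro sum.mono_neutral_cong_right) (auto simp: a_def)
    then show "(\<Sum>v\<in>D. a v *\<^sub>R v) = x" using a0 by simp
  qed
  define \<phi> :: "'a set \<Rightarrow> 'a \<Rightarrow> 'a \<Rightarrow> real" where
    "\<phi> \<tau> v = (SOME f. continuous_on UNIV f \<and>
        (\<forall>u. sum u (vertices \<tau>) = 1 \<longrightarrow> f (\<Sum>w\<in>vertices \<tau>. u w *\<^sub>R w) = u v))" for \<tau> v
  have \<phi>: "continuous_on UNIV (\<phi> \<tau> v) \<and>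
        (\<forall>u. sum u (vertices \<tau>) = 1 \<longrightarrow> \<phi> \<tau> v (\<Sum>w\<in>vertices \<tau>. u w *\<^sub>R w) = u v)"
    if "\<tau> \<in> K" "v \<in> vertices \<tau>" for \<tau> v
    unfolding \<phi>_def by (rule someI_ex[OF barycentric_coordinate[OF complex_vertices(1)[OF K that(1)] that(2)]])
  have \<phi>_cont: "continuous_on UNIV (\<phi> \<tau> v)" if "\<tau> \<in> K" "v \<in> vertices \<tau>" for \<tau> v
    using \<phi>[OF that] by (rule conjunct1)
  have \<phi>_eq: "\<phi> \<tau> v (\<Sum>w\<in>vertices \<tau>. u w *\<^sub>R w) = u v"
    if "\<tau> \<in> K" "v \<in> vertices \<tau>" "sum u (vertices \<tau>) = 1" for \<tau> v u
    by (rule mp[OF spec[OF conjunct2[OF \<phi>[OF that(1,2)]], of u] that(3)])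
  have coords: "\<exists>u. (\<forall>w\<in>D. 0 \<le> u w) \<and> (\<forall>w. w \<notin> D \<longrightarrow> u w = 0) \<and>
       (\<forall>E. finite E \<longrightarrow> D \<subseteq> E \<longrightarrow> sum u E = 1 \<and> (\<Sum>w\<in>E. u w *\<^sub>R w) = y)"
    if D: "finite D" "y \<in> convex hull D" for D :: "'a set" and y
  proof -
    obtain u where u: "\<forall>w\<in>D. 0 \<le> u w" "sum u D = 1" "(\<Sum>w\<in>D. u w *\<^sub>R w) = y"
      using D(2) unfolding convex_hull_finite[OF D(1)] by blast
    let ?u = "\<lambda>w. if w \<in> D then u w else 0"
    have "sum ?u E = 1 \<and> (\<Sum>w\<in>E. ?u w *\<^sub>R w) = y" if "finite E" "D \<subseteq> E" for E
    proof -
      have "sum ?u E = sum u D" "(\<Sum>w\<in>E. ?u w *\<^sub>R w) = (\<Sum>w\<in>D. u w *\<^sub>R w)"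
        using that by (intro sum.mono_neutral_cong_right; auto)+
      then show ?thesis using u by simp
    qed
    then show ?thesis using u by (intro exI[of _ ?u]) auto
  qed
  \<comment> \<open>\<open>f \<tau>\<close> is the function \<open>q\<close> on the simplex \<open>\<tau>\<close>; off the star of \<open>\<sigma>\<close> it is \<open>0\<close>, so that nothing moves there.\<close>
  define f where "f \<tau> y = (if \<sigma> \<subseteq> \<tau> then Min ((\<lambda>v. \<phi> \<tau> v y / a v) ` ?C) else 0)" for \<tau> y
  define g where "g y = f (SOME \<tau>. \<tau> \<in> K \<and> y \<in> \<tau>) y" for y
  have f_eq: "f \<tau> y = Min ((\<lambda>v. u v / a v) ` ?C)"
    if "\<tau> \<in> K" "\<sigma> \<subseteq> \<tau>" "sum u (vertices \<tau>) = 1" "(\<Sum>w\<in>vertices \<tau>. u w *\<^sub>R w) = y" for \<tau> y u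
  proof -
    have "?C \<subseteq> vertices \<tau>" using complex_subset_iff[OF K s that(1)] that(2) by simp
    then have "(\<lambda>v. \<phi> \<tau> v y / a v) ` ?C = (\<lambda>v. u v / a v) ` ?C"
      using \<phi>_eq[OF that(1) _ that(3)] that(4) by (intro image_cong) auto
    then show ?thesis using that(2) by (simp add: f_def)
  qed
  \<comment> \<open>On a common face both values are read off the same coordinates; if that face misses a vertex of \<open>\<sigma>\<close>, the minimum is \<open>0\<close>.\<close>
  have f_agree: "f \<tau> y = f \<tau>' y" if t: "\<tau> \<in> K" "\<tau>' \<in> K" "y \<in> \<tau>" "y \<in> \<tau>'" for \<tau> \<tau>' y
  proof -
    have "(\<tau> \<inter> \<tau>') face_of \<tau>" using K t unfolding simplicial_complex_def by blast
    then have \<rho>: "\<tau> \<inter> \<tau>' \<in> K" using K t unfolding simplicial_complex_def by blast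
    let ?U = "vertices (\<tau> \<inter> \<tau>')"
    have sub: "?U \<subseteq> vertices \<tau>" "?U \<subseteq> vertices \<tau>'"
      using complex_subset_iff[OF K \<rho>] t by blast+
    obtain u where u: "\<forall>w\<in>?U. 0 \<le> u w" "\<forall>w. w \<notin> ?U \<longrightarrow> u w = 0"
       "\<And>E. finite E \<Longrightarrow> ?U \<subseteq> E \<Longrightarrow> sum u E = 1 \<and> (\<Sum>w\<in>E. u w *\<^sub>R w) = y"
      using coords[of ?U y] complex_vertices[OF K \<rho>] t by auto
    have u0: "0 \<le> u w" for w using u(1,2) by (cases "w \<in> ?U") auto
    have eq: "f \<rho>' y = Min ((\<lambda>v. u v / a v) ` ?C)" if "\<rho>' \<in> {\<tau>, \<tau>'}" "\<sigma> \<subseteq> \<rho>'" for \<rho>'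
      using that t sub u(3)[of "vertices \<rho>'"] complex_vertices(2)[OF K, of \<rho>'] by (intro f_eq) auto
    have zero: "f \<rho>' y = 0" if "\<rho>' \<in> {\<tau>, \<tau>'}" "\<not> (\<sigma> \<subseteq> \<tau> \<and> \<sigma> \<subseteq> \<tau>')" for \<rho>'
    proof (cases "\<sigma> \<subseteq> \<rho>'")
      case True
      have "\<not> ?C \<subseteq> ?U" using complex_subset_iff[OF K s \<rho>] that(2) by auto
      then obtain v where v: "v \<in> ?C" "v \<notin> ?U" by blast
      have "Min ((\<lambda>v. u v / a v) ` ?C) = 0"
      proof (rule Min_eqI)
        show "0 \<in> (\<lambda>v. u v / a v) ` ?C" using v u(2) by (intro image_eqI[of _ _ v]) auto
        show "0 \<le> z" if "z \<in> (\<lambda>v. u v / a v) ` ?C" for z using that u0 a_nonneg by auto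
      qed (use Cs in auto)
      then show ?thesis using eq[OF that(1) True] by simp
    qed (simp add: f_def)
    show ?thesis using eq zero by (cases "\<sigma> \<subseteq> \<tau> \<and> \<sigma> \<subseteq> \<tau>'") auto
  qed
  have g_eq: "g y = f \<tau> y" if "\<tau> \<in> K" "y \<in> \<tau>" for \<tau> y
  proof -
    have "(SOME \<tau>. \<tau> \<in> K \<and> y \<in> \<tau>) \<in> K \<and> y \<in> (SOME \<tau>. \<tau> \<in> K \<and> y \<in> \<tau>)"
      by (rule someI[of _ \<tau>]) (use that in auto)
    then show ?thesis unfolding g_def using f_agree that by blast
  qed
  have f_cont: "continuous_on \<tau> (f \<tau>)" if "\<tau> \<in> K" for \<tau>
  proof (cases "\<sigma> \<subseteq> \<tau>")
    case True
    then have "?C \<subseteq> vertices \<tau>" using complex_subset_iff[OF K s that(1)] by simp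
    then have "continuous_on \<tau> (\<lambda>y. \<phi> \<tau> v y / a v)" if "v \<in> ?C" for v
      using that a_pos[OF that] continuous_on_subset[OF \<phi>_cont[OF \<open>\<tau> \<in> K\<close>, of v]]
      by (intro continuous_on_divide continuous_on_const) auto
    then have "continuous_on \<tau> (\<lambda>y. Min ((\<lambda>v. \<phi> \<tau> v y / a v) ` ?C))"
      by (rule continuous_on_Min_image[OF Cs(2) Cne])
    moreover have "f \<tau> = (\<lambda>y. Min ((\<lambda>v. \<phi> \<tau> v y / a v) ` ?C))" using True by (auto simp: f_def)
    ultimately show ?thesis by simp
  next
    case False
    then have "f \<tau> = (\<lambda>_. 0)" by (simp add: f_def fun_eq_iff)
    then show ?thesis by simp
  qed
  have g_cont: "continuous_on (\<Union>K) g"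
  proof -
    have "continuous_on (\<Union>\<tau>\<in>K. \<tau>) g"
    proof (rule continuous_on_closed_Union)
      show "finite K" using K unfolding simplicial_complex_def by blast
      show "closed \<tau>" if "\<tau> \<in> K" for \<tau>
        using K that closed_simplex unfolding simplicial_complex_def by blast
      show "continuous_on \<tau> g" if "\<tau> \<in> K" for \<tau>
        using f_cont[OF that] by (rule continuous_on_eq) (simp add: g_eq[OF that])
    qed
    then show ?thesis by simp
  qed
  have key: "g y < 1 \<and> (\<exists>\<rho>\<in>K. \<rho> \<subseteq> \<tau> \<and> x \<notin> \<rho> \<and> x + (1 / (1 - g y)) *\<^sub>R (y - x) \<in> \<rho>)"
    if t: "\<tau> \<in> K" "y \<in> \<tau>" "\<sigma> \<subseteq> \<tau>" and yx: "y \<noteq> x" for y \<tau>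
  proof -
    let ?D = "vertices \<tau>"
    note D = complex_vertices[OF K t(1)]
    have CD: "?C \<subseteq> ?D" using complex_subset_iff[OF K s t(1)] t(3) by simp
    have "y \<in> convex hull ?D" using t(2) D(3) by simp
    then obtain u where u: "\<forall>w\<in>?D. 0 \<le> u w" "sum u ?D = 1" "(\<Sum>w\<in>?D. u w *\<^sub>R w) = y"
      unfolding convex_hull_finite[OF D(2)] by blast
    define q where "q = g y"
    have q: "q = Min ((\<lambda>v. u v / a v) ` ?C)"
      using g_eq[OF t(1,2)] f_eq[OF t(1,3) u(2,3)] by (simp add: q_def)
    have "q \<in> (\<lambda>v. u v / a v) ` ?C" unfolding q using Cs Cne by (intro Min_in) auto
    then obtain v where v: "v \<in> ?C" "q = u v / a v" by auto
    have le: "q * a w \<le> u w" if "w \<in> ?D" for w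
    proof (cases "w \<in> ?C")
      case True
      then have "q \<le> u w / a w" unfolding q using Cs by (intro Min_le) auto
      then show ?thesis using a_pos[OF True] by (simp add: field_simps)
    next
      case False
      then show ?thesis using u(1) that by (simp add: a_def)
    qed
    have s1: "(\<Sum>w\<in>?D. u w - q * a w) = 1 - q"
      using u(2) a_sum[OF D(2) CD] by (simp add: sum_subtractf flip: sum_distrib_left)
    have "0 \<le> (\<Sum>w\<in>?D. u w - q * a w)" using le by (intro sum_nonneg) simp
    then have "q \<le> 1" using s1 by simp
    \<comment> \<open>If \<open>q = 1\<close>, then \<open>u\<close> dominates \<open>a\<close>, and as both sum to \<open>1\<close> they agree.\<close>
    moreover have "q \<noteq> 1"
    proof
      assume "q = 1"
      then have "(\<Sum>w\<in>?D. u w - q * a w) = 0" using s1 by simp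
      then have "\<forall>w\<in>?D. u w - q * a w = 0"
        using le by (subst (asm) sum_nonneg_eq_0_iff[OF D(2)]) auto
      then have "y = (\<Sum>w\<in>?D. a w *\<^sub>R w)" unfolding u(3)[symmetric] using \<open>q = 1\<close> by (intro sum.cong) auto
      then show False using yx a_x[OF D(2) CD] by simp
    qed
    ultimately have q1: "q < 1" by simp
    let ?z = "x + (1 / (1 - q)) *\<^sub>R (y - x)"
    define t' where "t' w = (u w - q * a w) / (1 - q)" for w
    have t0: "\<forall>w\<in>?D - {v}. 0 \<le> t' w" using le q1 by (auto simp: t'_def)
    have tv: "t' v = 0" using v a_pos[OF v(1)] by (simp add: t'_def)
    have ts: "sum t' ?D = 1" using s1 q1 by (simp add: t'_def flip: sum_divide_distrib)
    have "(\<Sum>w\<in>?D. t' w *\<^sub>R w) = (\<Sum>w\<in>?D. (1 / (1 - q)) *\<^sub>R (u w *\<^sub>R w - q *\<^sub>R (a w *\<^sub>R w)))"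
      by (rule sum.cong) (auto simp: t'_def scaleR_diff_left scaleR_diff_right diff_divide_distrib)
    also have "\<dots> = (1 / (1 - q)) *\<^sub>R (y - q *\<^sub>R x)"
      unfolding scaleR_sum_right[symmetric] sum_subtractf u(3) a_x[OF D(2) CD] ..
    also have "\<dots> = ?z"
    proof -
      have "x = (1 / (1 - q)) *\<^sub>R ((1 - q) *\<^sub>R x)" using q1 by simp
      then have "?z = (1 / (1 - q)) *\<^sub>R ((1 - q) *\<^sub>R x + (y - x))" by (metis scaleR_add_right)
      then show ?thesis by (simp add: scaleR_diff_left)
    qed
    finally have tz: "(\<Sum>w\<in>?D. t' w *\<^sub>R w) = ?z" .
    have vD: "v \<in> ?D" using v CD by blast
    have "sum t' (?D - {v}) = 1" "(\<Sum>w\<in>?D - {v}. t' w *\<^sub>R w) = ?z"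
      using ts tz tv by (simp_all add: sum.remove[OF D(2) vD])
    then have "?z \<in> convex hull (?D - {v})"
      using t0 D(2) by (subst convex_hull_finite) auto
    moreover note hf = complex_hull_face[OF K t(1), of "?D - {v}"]
    moreover have "x \<notin> convex hull (?D - {v})"
    proof
      assume "x \<in> convex hull (?D - {v})"
      then have "\<sigma> \<subseteq> convex hull (?D - {v})" using rel_interior_mem_iff[OF K s _ x] hf by blast
      then have "?C \<subseteq> ?D - {v}" using complex_subset_iff[OF K s] hf by blast
      then show False using v by blast
    qed
    moreover have "convex hull (?D - {v}) \<subseteq> \<tau>" using hull_mono[of "?D - {v}" ?D convex] D(3) by auto
    ultimately show ?thesis using q1 unfolding q_def by blast
  qed
  have g0: "g y = 0" if "\<tau> \<in> K" "y \<in> \<tau>" "x \<notin> \<tau>" for \<tau> y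
    using g_eq[OF that(1,2)] rel_interior_mem_iff[OF K s that(1) x] that(3) by (simp add: f_def)
  have gl: "g y < 1" if "y \<in> \<Union>K - {x}" for y
  proof -
    obtain \<tau> where t: "\<tau> \<in> K" "y \<in> \<tau>" using \<open>y \<in> \<Union>K - {x}\<close> by blast
    show ?thesis
    proof (cases "\<sigma> \<subseteq> \<tau>")
      case True
      then show ?thesis using key[OF t True] that by blast
    next
      case False
      then have "x \<notin> \<tau>" using rel_interior_mem_iff[OF K s t(1) x] by blast
      then show ?thesis using g0[OF t] by simp
    qed
  qed
  define r where "r y = x + (1 / (1 - g y)) *\<^sub>R (y - x)" for y
  show thesis
  proof (rule that[of r])
    show "continuous_on (\<Union>K - {x}) r"
      unfolding r_def using gl
      by (intro continuous_intros continuous_on_subset[OF g_cont]) force+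
    show r_id: "r y = y" if "y \<in> \<Union>{\<tau>\<in>K. x \<notin> \<tau>}" for y
      using that g0 by (auto simp: r_def)
    have where_r: "\<exists>\<tau>\<in>K. y \<in> \<tau> \<and> r y \<in> \<tau> \<and> r y \<in> \<Union>{\<tau>\<in>K. x \<notin> \<tau>}" if y: "y \<in> \<Union>K - {x}" for y
    proof -
      obtain \<tau> where t: "\<tau> \<in> K" "y \<in> \<tau>" using y by blast
      show ?thesis
      proof (cases "\<sigma> \<subseteq> \<tau>")
        case True
        then show ?thesis using key[OF t True] y t unfolding r_def by blast
      next
        case False
        then have "x \<notin> \<tau>" using rel_interior_mem_iff[OF K s t(1) x] by blast
        then have "y \<in> \<Union>{\<tau>\<in>K. x \<notin> \<tau>}" using t by blast
        then show ?thesis using r_id[of y] t by metis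
      qed
    qed
    then show "r y \<in> \<Union>{\<tau>\<in>K. x \<notin> \<tau>}" if "y \<in> \<Union>K - {x}" for y
      using where_r[OF that] by blast
    show "closed_segment (r y) y \<subseteq> \<Union>K - {x}" if y: "y \<in> \<Union>K - {x}" for y
    proof
      fix z assume "z \<in> closed_segment (r y) y"
      then obtain t where t: "0 \<le> t" "t \<le> 1" "z = (1 - t) *\<^sub>R r y + t *\<^sub>R y" by (auto simp: in_segment)
      obtain \<tau> where T: "\<tau> \<in> K" "y \<in> \<tau>" "r y \<in> \<tau>" using where_r[OF y] by blast
      have "convex \<tau>" using K T(1) convex_simplex unfolding simplicial_complex_def by blast
      then have "z \<in> \<tau>" using T t unfolding convex_alt by blast
      moreover have "z \<noteq> x"
      proof -
        have "z - x = ((1 - t) * (1 / (1 - g y)) + t) *\<^sub>R (y - x)"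
          unfolding t(3) r_def by (simp add: algebra_simps)
        moreover have "(1 - t) * (1 / (1 - g y)) + t > 0"
        proof (cases "t = 1")
          case False
          then have "(1 - t) * (1 / (1 - g y)) > 0" using t gl[OF y] by (intro mult_pos_pos) auto
          then show ?thesis using t by linarith
        qed simp
        ultimately show ?thesis using y by auto
      qed
      ultimately show "z \<in> \<Union>K - {x}" using T by blast
    qed
  qed
qed

corollary homology_punctured_complex:
  fixes K :: "'a::euclidean_space set set"
  assumes "simplicial_complex K" "\<sigma> \<in> K" "x \<in> rel_interior \<sigma>"
  shows "homology_group p (top_of_set (\<Union>K - {x})) \<cong> homology_group p (top_of_set (\<Union>{\<tau>\<in>K. x \<notin> \<tau>}))"
proof -
  let ?Y = "\<Union>K - {x}" and ?Z = "\<Union>{\<tau>\<in>K. x \<notin> \<tau>}"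
  obtain r where r: "continuous_on ?Y r" "\<And>y. y \<in> ?Y \<Longrightarrow> r y \<in> ?Z" "\<And>y. y \<in> ?Z \<Longrightarrow> r y = y"
    "\<And>y. y \<in> ?Y \<Longrightarrow> closed_segment (r y) y \<subseteq> ?Y"
    using punctured_complex_retraction[OF assms] by blast
  have ZY: "?Z \<subseteq> ?Y" by blast
  show ?thesis
  proof (rule deformation_retract_imp_isomorphic_homology_groups)
    show "retraction_maps (top_of_set ?Y) (top_of_set ?Z) r id"
      unfolding retraction_maps_def using r ZY by (auto simp: continuous_map_in_subtopology)
    show "homotopic_with (\<lambda>h. True) (top_of_set ?Y) (top_of_set ?Y) r id"
      using r by (intro homotopic_with_linear) (auto simp: continuous_on_id)
  qed
qed


section \<open>Euler characteristics of complexes and stars in manifolds\<close>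

text \<open>
  The ball is stretched radially onto the affine set.
\<close>

lemma homeomorphic_affine_ball:
  fixes A :: "'a::euclidean_space set"
  assumes A: "affine A" and b: "b \<in> A" and e: "e > 0" and k: "aff_dim A = int k"
  shows "top_of_set (ball b e \<inter> A) homeomorphic_space Euclidean_space k"
proof -
  let ?f = "\<lambda>y. b + (1 / (e - norm (y - b))) *\<^sub>R (y - b)"
  let ?g = "\<lambda>z. b + (e / (1 + norm (z - b))) *\<^sub>R (z - b)"
  have mem: "b + c *\<^sub>R (y - b) \<in> A" if "y \<in> A" for c y
  proof -
    have "(1 - c) *\<^sub>R b + c *\<^sub>R y \<in> A" using A b that unfolding affine_alt by blast
    then show ?thesis by (simp add: algebra_simps)
  qed
  have ball: "norm (y - b) < e" if "y \<in> ball b e" for y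
    using that by (simp add: dist_norm norm_minus_commute)
  have "homeomorphism (ball b e \<inter> A) A ?f ?g"
  proof (rule homeomorphismI)
    show "continuous_on (ball b e \<inter> A) ?f"
      by (intro continuous_intros) (use ball in force)
    show "continuous_on A ?g"
      by (intro continuous_intros) (simp add: add_nonneg_eq_0_iff)
    show "?f ` (ball b e \<inter> A) \<subseteq> A" using mem by blast
    have "?g z \<in> ball b e" for z
    proof -
      have "norm (?g z - b) = e * (norm (z - b) / (1 + norm (z - b)))" using e by simp
      also have "\<dots> < e * 1" using e by (intro mult_strict_left_mono) (auto simp: divide_less_eq add_pos_nonneg)
      finally show ?thesis by (simp add: dist_norm norm_minus_commute)
    qed
    then show "?g ` A \<subseteq> ball b e \<inter> A" using mem by blast
    show "?g (?f y) = y" if y: "y \<in> ball b e \<inter> A" for y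
    proof -
      let ?w = "norm (y - b)"
      have w: "?w < e" using ball y by blast
      have "norm (?f y - b) = ?w / (e - ?w)" using w by simp
      then have "1 + norm (?f y - b) = e / (e - ?w)" using w by (simp add: field_simps)
      then have "e / (1 + norm (?f y - b)) = e - ?w" using w e by (simp only:) simp
      then have "?g (?f y) = b + (e - ?w) *\<^sub>R ((1 / (e - ?w)) *\<^sub>R (y - b))" by simp
      then show ?thesis using w by simp
    qed
    show "?f (?g z) = z" for z
    proof -
      let ?w = "norm (z - b)"
      have w: "1 + ?w > 0" by (simp add: add_pos_nonneg)
      have "norm (?g z - b) = e / (1 + ?w) * ?w" using e w by simp
      then have "e - norm (?g z - b) = e / (1 + ?w)" using w by (simp add: field_simps)
      then have "1 / (e - norm (?g z - b)) = (1 + ?w) / e" using w e by (simp only:) simp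
      then have "?f (?g z) = b + ((1 + ?w) / e) *\<^sub>R ((e / (1 + ?w)) *\<^sub>R (z - b))" by simp
      then show ?thesis using w e by simp
    qed
  qed
  then have "top_of_set (ball b e \<inter> A) homeomorphic_space top_of_set A"
    unfolding homeomorphic_space_iff_homeomorphic homeomorphic_def by blast
  moreover have "top_of_set A homeomorphic_space Euclidean_space k"
    using homeomorphic_affine_Euclidean_space[OF A] k by blast
  ultimately show ?thesis by (rule homeomorphic_space_trans)
qed

lemma simplicial_complex_subcomplex:
  assumes "simplicial_complex K" "L \<subseteq> K" "\<And>\<sigma> F. \<sigma> \<in> L \<Longrightarrow> F face_of \<sigma> \<Longrightarrow> F \<in> L"
  shows "simplicial_complex L"
  unfolding simplicial_complex_def
proof (intro conjI ballI allI impI)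
  show "finite L" using assms(1,2) unfolding simplicial_complex_def by (meson finite_subset)
  show "\<exists>n. n simplex \<sigma>" if "\<sigma> \<in> L" for \<sigma>
    using assms(1,2) that unfolding simplicial_complex_def by blast
  show "F \<in> L" if "\<sigma> \<in> L \<and> F face_of \<sigma>" for F \<sigma>
    using that assms(3) by (elim conjE)
  show "\<sigma> \<inter> \<rho> face_of \<sigma>" if "\<sigma> \<in> L \<and> \<rho> \<in> L" for \<sigma> \<rho>
    using assms(1,2) that unfolding simplicial_complex_def by blast
qed

lemma subcomplex_avoiding_point:
  assumes K: "simplicial_complex K"
  shows "simplicial_complex {\<tau> \<in> K. x \<notin> \<tau>}"
proof (rule simplicial_complex_subcomplex[OF K])
  fix \<sigma> F assume "\<sigma> \<in> {\<tau> \<in> K. x \<notin> \<tau>}" "F face_of \<sigma>"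
  then show "F \<in> {\<tau> \<in> K. x \<notin> \<tau>}"
    using K face_of_imp_subset unfolding simplicial_complex_def by blast
qed auto

lemma complex_rel_interior_point:
  assumes "simplicial_complex K" "\<sigma> \<in> K" "\<sigma> \<noteq> {}"
  obtains x where "x \<in> rel_interior \<sigma>"
proof -
  have "convex \<sigma>" using assms convex_simplex unfolding simplicial_complex_def by blast
  then show thesis using that rel_interior_eq_empty assms(3) by blast
qed

text \<open>
  A small ball around \<open>b\<close> avoids all other simplices, since none of them contains \<open>b\<close>, and meets \<open>\<tau>\<close> in a
  ball of its affine hull.
\<close>

lemma local_betti_at_maximal_simplex:
  fixes K :: "'a::euclidean_space set set"
  assumes K: "simplicial_complex K" and t: "\<tau> \<in> K" and max: "\<And>\<rho>. \<rho> \<in> K \<Longrightarrow> \<tau> \<subseteq> \<rho> \<Longrightarrow> \<rho> = \<tau>"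
    and b: "b \<in> rel_interior \<tau>" and k: "card (vertices \<tau>) = Suc k"
  shows "relative_betti p (top_of_set (\<Union>K)) (\<Union>K - {b}) (if p = int k then 1 else 0)"
proof -
  have bt: "b \<in> \<tau>" using b rel_interior_subset by blast
  obtain e1 where e1: "e1 > 0" "ball b e1 \<inter> affine hull \<tau> \<subseteq> \<tau>"
    using b unfolding mem_rel_interior_ball by blast
  let ?R = "\<Union>(K - {\<tau>})"
  have "finite K" using K unfolding simplicial_complex_def by blast
  moreover have "closed \<rho>" if "\<rho> \<in> K" for \<rho>
    using K that closed_simplex unfolding simplicial_complex_def by blast
  ultimately have "closed ?R" by (intro closed_Union) auto
  moreover have "b \<notin> ?R" using rel_interior_mem_iff[OF K t _ b] max by blast
  ultimately obtain e2 where e2: "e2 > 0" "ball b e2 \<inter> ?R = {}"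
    using open_Compl[of ?R] unfolding open_contains_ball by (metis ComplI disjoint_eq_subset_Compl)
  define e where "e = min e1 e2"
  have e: "e > 0" using e1 e2 by (simp add: e_def)
  \<comment> \<open>Inside the small ball the polyhedron looks like the affine hull of \<open>\<tau>\<close>.\<close>
  have eq: "\<Union>K \<inter> ball b e = ball b e \<inter> affine hull \<tau>"
  proof (intro equalityI subsetI)
    fix y assume y: "y \<in> \<Union>K \<inter> ball b e"
    then have "y \<notin> ?R" using e2 by (auto simp: e_def)
    then have "y \<in> \<tau>" using y by blast
    then have "y \<in> affine hull \<tau>" by (rule hull_inc)
    then show "y \<in> ball b e \<inter> affine hull \<tau>" using y by blast
  next
    fix y assume y: "y \<in> ball b e \<inter> affine hull \<tau>"
    then have "y \<in> ball b e1 \<inter> affine hull \<tau>" by (simp add: e_def)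
    then have "y \<in> \<tau>" using e1(2) by blast
    then show "y \<in> \<Union>K \<inter> ball b e" using y t by blast
  qed
  obtain m where m: "m simplex \<tau>" using K t unfolding simplicial_complex_def by blast
  have "aff_dim (affine hull \<tau>) = int k"
    using aff_dim_simplex[OF m] simplex_vertices(3)[OF m] k by (simp add: aff_dim_affine_hull)
  then have "top_of_set (ball b e \<inter> affine hull \<tau>) homeomorphic_space Euclidean_space k"
    using bt e by (intro homeomorphic_affine_ball) (auto intro: hull_inc)
  then have hom: "subtopology (top_of_set (\<Union>K)) (\<Union>K \<inter> ball b e) homeomorphic_space Euclidean_space k"
    unfolding subtopology_subtopology by (simp add: eq[symmetric])
  have "relative_betti p (top_of_set (\<Union>K)) (topspace (top_of_set (\<Union>K)) - {b}) (if p = int k then 1 else 0)"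
  proof (rule local_betti_at_Euclidean_point[OF _ _ _ hom])
    show "Hausdorff_space (top_of_set (\<Union>K))" by (simp add: Hausdorff_space_subtopology)
    show "openin (top_of_set (\<Union>K)) (\<Union>K \<inter> ball b e)" by (simp add: openin_open_Int)
    show "b \<in> \<Union>K \<inter> ball b e" using bt t e by auto
  qed
  then show ?thesis by simp
qed

text \<open>
  By the retraction, the punctured polyhedron has the homology of the subcomplex of the simplices that
  miss \<open>x\<close>.
\<close>

lemma has_euler_char_fill_point:
  fixes K :: "'a::euclidean_space set set"
  assumes K: "simplicial_complex K" "\<sigma> \<in> K" "x \<in> rel_interior \<sigma>"
    and c: "has_euler_char (top_of_set (\<Union>{\<tau>\<in>K. x \<notin> \<tau>})) c"
    and R: "\<And>p. relative_betti p (top_of_set (\<Union>K)) (\<Union>K - {x}) (if p = int k then 1 else 0)"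
  shows "has_euler_char (top_of_set (\<Union>K)) (c + (-1) ^ k)"
proof -
  have "has_euler_char (top_of_set (\<Union>K - {x})) c"
    using group.iso_sym[OF group_relative_homology_group homology_punctured_complex[OF K]] c
    by (rule has_euler_char_iso)
  moreover have "subtopology (top_of_set (\<Union>K)) (\<Union>K - {x}) = top_of_set (\<Union>K - {x})"
    by (simp add: subtopology_subtopology Int_absorb1)
  ultimately show ?thesis using R by (intro has_euler_char_add_cell[of _ "\<Union>K - {x}"]) auto
qed

text \<open>
  Puncturing a simplex of largest dimension at an interior point leaves, up to homotopy, the complex
  without that simplex.
\<close>

theorem has_euler_char_complex:
  fixes K :: "'a::euclidean_space set set"
  assumes "simplicial_complex K"
  shows "has_euler_char (top_of_set (\<Union>K)) (- (\<Sum>\<tau>\<in>K - {{}}. (-1) ^ card (vertices \<tau>)))"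
  using assms
proof (induction "card K" arbitrary: K rule: less_induct)
  case less
  note K = less.prems
  have fin: "finite K" using K unfolding simplicial_complex_def by blast
  show ?case
  proof (cases "K - {{}} = {}")
    case True
    then have U: "\<Union>K = {}" by blast
    show ?thesis unfolding True U by (simp add: has_euler_char_empty)
  next
    case False
    let ?c = "\<lambda>\<rho>. card (vertices \<rho>)"
    have finc: "finite (?c ` (K - {{}}))" using fin by simp
    have "Max (?c ` (K - {{}})) \<in> ?c ` (K - {{}})" using finc False by (intro Max_in) auto
    then obtain \<tau> where t: "\<tau> \<in> K - {{}}" and tmax: "Max (?c ` (K - {{}})) = ?c \<tau>" by (rule imageE)
    have maxc: "?c \<rho> \<le> ?c \<tau>" if "\<rho> \<in> K - {{}}" for \<rho>
      unfolding tmax[symmetric] using finc that by (intro Max_ge imageI)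
    have tK: "\<tau> \<in> K" "\<tau> \<noteq> {}" using t by auto
    have max: "\<rho> = \<tau>" if "\<rho> \<in> K" "\<tau> \<subseteq> \<rho>" for \<rho>
    proof -
      have "vertices \<tau> \<subseteq> vertices \<rho>" using complex_subset_iff[OF K tK(1) that(1)] that(2) by simp
      moreover have "card (vertices \<rho>) \<le> card (vertices \<tau>)" using maxc that tK by blast
      ultimately have "vertices \<tau> = vertices \<rho>" using card_seteq complex_vertices(2)[OF K that(1)] by blast
      then show ?thesis using complex_vertices(3)[OF K] that(1) tK(1) by metis
    qed
    obtain b where b: "b \<in> rel_interior \<tau>" using complex_rel_interior_point[OF K tK] by blast
    have avoid: "{\<rho> \<in> K. b \<notin> \<rho>} = K - {\<tau>}"
      using rel_interior_mem_iff[OF K tK(1) _ b] max by blast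
    have "vertices \<tau> \<noteq> {}" using complex_vertices(3)[OF K tK(1)] tK(2) by auto
    then obtain k where k: "card (vertices \<tau>) = Suc k"
      using complex_vertices(2)[OF K tK(1)] by (metis card_eq_0_iff not0_implies_Suc)
    have sc: "simplicial_complex (K - {\<tau>})" using subcomplex_avoiding_point[OF K, of b] avoid by simp
    have "card (K - {\<tau>}) < card K" using fin tK(1) by (rule card_Diff1_less)
    from less.hyps[OF this sc]
    have "has_euler_char (top_of_set (\<Union>(K - {\<tau>}))) (- (\<Sum>\<rho>\<in>K - {\<tau>} - {{}}. (-1) ^ card (vertices \<rho>)))" .
    then have "has_euler_char (top_of_set (\<Union>K)) (- (\<Sum>\<rho>\<in>K - {\<tau>} - {{}}. (-1) ^ card (vertices \<rho>)) + (-1) ^ k)"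
      using local_betti_at_maximal_simplex[OF K tK(1) max b k]
      by (intro has_euler_char_fill_point[OF K tK(1) b]) (simp_all add: avoid)
    moreover have "(\<Sum>\<rho>\<in>K - {{}}. (-1) ^ card (vertices \<rho>)) =
        (-1) ^ card (vertices \<tau>) + (\<Sum>\<rho>\<in>K - {{}} - {\<tau>}. (-1 :: int) ^ card (vertices \<rho>))"
      using fin t by (intro sum.remove) auto
    moreover have "K - {{}} - {\<tau>} = K - {\<tau>} - {{}}" by blast
    ultimately show ?thesis by (simp add: k)
  qed
qed

lemma manifold_local_betti:
  assumes M: "closed_manifold n (top_of_set S)" and x: "x \<in> S"
  shows "relative_betti p (top_of_set S) (S - {x}) (if p = int n then 1 else 0)"
proof -
  have "\<forall>y\<in>topspace (top_of_set S). \<exists>U. openin (top_of_set S) U \<and> y \<in> U \<and>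
      subtopology (top_of_set S) U homeomorphic_space Euclidean_space n"
    using M unfolding closed_manifold_def by (elim conjE)
  moreover have "x \<in> topspace (top_of_set S)" using x by simp
  ultimately obtain U where "openin (top_of_set S) U" "x \<in> U"
    "subtopology (top_of_set S) U homeomorphic_space Euclidean_space n" by blast
  moreover have "Hausdorff_space (top_of_set S)" using M unfolding closed_manifold_def by blast
  ultimately have "relative_betti p (top_of_set S) (topspace (top_of_set S) - {x}) (if p = int n then 1 else 0)"
    by (intro local_betti_at_Euclidean_point)
  then show ?thesis by simp
qed

text \<open>
  The Euler characteristic of the complex is computed twice: by counting all simplices, and by filling
  in a point of the relative interior of \<open>\<sigma>\<close>, which lies in exactly those simplices that contain \<open>\<sigma>\<close>.
\<close>

theorem manifold_star_euler_char:
  fixes K :: "'a::euclidean_space set set"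
  assumes K: "simplicial_complex K" and M: "closed_manifold n (top_of_set (\<Union>K))"
    and s: "\<sigma> \<in> K" "\<sigma> \<noteq> {}"
  shows "(\<Sum>\<rho> | \<rho> \<in> K \<and> \<sigma> \<subseteq> \<rho>. (-1) ^ card (vertices \<rho>)) = ((-1) ^ (n + 1) :: int)"
proof -
  obtain x where x: "x \<in> rel_interior \<sigma>" using complex_rel_interior_point[OF K s] by blast
  have xK: "x \<in> \<Union>K" using x s rel_interior_subset by blast
  have fin: "finite K" using K unfolding simplicial_complex_def by blast
  let ?L = "{\<tau>\<in>K. x \<notin> \<tau>}" and ?s = "\<lambda>\<rho>. (-1 :: int) ^ card (vertices \<rho>)"
  have "has_euler_char (top_of_set (\<Union>K)) (- (\<Sum>\<tau>\<in>?L - {{}}. ?s \<tau>) + (-1) ^ n)"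
    using has_euler_char_complex[OF subcomplex_avoiding_point[OF K, of x]]
      manifold_local_betti[OF M xK] by (rule has_euler_char_fill_point[OF K s(1) x])
  then have eq: "- (\<Sum>\<tau>\<in>K - {{}}. ?s \<tau>) = - (\<Sum>\<tau>\<in>?L - {{}}. ?s \<tau>) + (-1) ^ n"
    using has_euler_char_complex[OF K] has_euler_char_unique by blast
  have "K - {{}} = (?L - {{}}) \<union> {\<rho> \<in> K. \<sigma> \<subseteq> \<rho>}" "(?L - {{}}) \<inter> {\<rho> \<in> K. \<sigma> \<subseteq> \<rho>} = {}"
    using rel_interior_mem_iff[OF K s(1) _ x] s(2) by auto
  then have "(\<Sum>\<tau>\<in>K - {{}}. ?s \<tau>) = (\<Sum>\<tau>\<in>?L - {{}}. ?s \<tau>) + (\<Sum>\<rho> | \<rho> \<in> K \<and> \<sigma> \<subseteq> \<rho>. ?s \<rho>)"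
    using fin by (simp add: sum.union_disjoint)
  then show ?thesis using eq by simp
qed

text \<open>
  The local homology at an interior point of \<open>\<tau>\<close> is concentrated in degree \<open>dim \<tau>\<close> by maximality and in
  degree \<open>n\<close> by the manifold condition.
\<close>

theorem manifold_maximal_simplex_dim:
  fixes K :: "'a::euclidean_space set set"
  assumes K: "simplicial_complex K" and M: "closed_manifold n (top_of_set (\<Union>K))"
    and t: "\<tau> \<in> K" "\<tau> \<noteq> {}" and max: "\<And>\<rho>. \<rho> \<in> K \<Longrightarrow> \<tau> \<subseteq> \<rho> \<Longrightarrow> \<rho> = \<tau>"
  shows "card (vertices \<tau>) = n + 1"
proof -
  obtain x where x: "x \<in> rel_interior \<tau>" using complex_rel_interior_point[OF K t] by blast
  have xK: "x \<in> \<Union>K" using x t rel_interior_subset by blast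
  have "vertices \<tau> \<noteq> {}" using complex_vertices(3)[OF K t(1)] t(2) by auto
  then obtain k where k: "card (vertices \<tau>) = Suc k"
    using complex_vertices(2)[OF K t(1)] by (metis card_eq_0_iff not0_implies_Suc)
  have "(if int n = int k then 1 else 0 :: nat) = (if int n = int n then 1 else 0)"
    using local_betti_at_maximal_simplex[OF K t(1) max x k] manifold_local_betti[OF M xK]
    by (rule relative_betti_unique)
  then have "n = k" by (cases "n = k") simp_all
  then show ?thesis using k by simp
qed

lemma manifold_pure:
  fixes K :: "'a::euclidean_space set set"
  assumes K: "simplicial_complex K" and M: "closed_manifold n (top_of_set (\<Union>K))"
    and s: "\<sigma> \<in> K" "\<sigma> \<noteq> {}"
  obtains \<tau> where "\<tau> \<in> K" "\<sigma> \<subseteq> \<tau>" "card (vertices \<tau>) = n + 1"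
proof -
  have fin: "finite K" using K unfolding simplicial_complex_def by blast
  obtain \<tau> where t: "\<tau> \<in> K" "\<sigma> \<subseteq> \<tau>" and max: "\<forall>\<rho>\<in>K. \<tau> \<subseteq> \<rho> \<longrightarrow> \<tau> = \<rho>"
    using finite_has_maximal2[OF fin s(1)] by blast
  have "card (vertices \<tau>) = n + 1"
    by (rule manifold_maximal_simplex_dim[OF K M t(1)]) (use t s max in auto)
  then show thesis by (rule that[OF t])
qed


section \<open>Counting faces of tiled complexes\<close>

lemma sum_interval_power_card:
  fixes x :: "'a::comm_ring_1"
  assumes "finite V" "W \<subseteq> V"
  shows "(\<Sum>U | W \<subseteq> U \<and> U \<subseteq> V. x ^ card U) = x ^ card W * (1 + x) ^ card (V - W)"
proof -
  have Pow: "(\<Sum>U\<in>Pow A. x ^ card U) = (1 + x) ^ card A" if "finite A" for A :: "'b set"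
    using that
  proof (induction A)
    case (insert a A)
    have "(\<Sum>U\<in>Pow (insert a A). x ^ card U) = (\<Sum>U\<in>Pow A. x ^ card U) + (\<Sum>U\<in>insert a ` Pow A. x ^ card U)"
      unfolding Pow_insert using insert by (intro sum.union_disjoint) auto
    also have "(\<Sum>U\<in>insert a ` Pow A. x ^ card U) = (\<Sum>U\<in>Pow A. x ^ card (insert a U))"
      using insert by (intro sum.reindex_cong[where l = "insert a"]) (auto simp: inj_on_def)
    also have "\<dots> = (\<Sum>U\<in>Pow A. x * x ^ card U)"
    proof (rule sum.cong[OF refl])
      fix U assume "U \<in> Pow A"
      then have "finite U" "a \<notin> U" using insert finite_subset by auto
      then show "x ^ card (insert a U) = x * x ^ card U" by simp
    qed
    finally show ?case using insert by (simp add: sum_distrib_left[symmetric] algebra_simps)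
  qed simp
  have "(\<Sum>U | W \<subseteq> U \<and> U \<subseteq> V. x ^ card U) = (\<Sum>U\<in>Pow (V - W). x ^ (card W + card U))"
  proof (rule sum.reindex_bij_witness[of _ "\<lambda>U. W \<union> U" "\<lambda>U. U - W"])
    fix U assume "U \<in> {U. W \<subseteq> U \<and> U \<subseteq> V}"
    then show "x ^ (card W + card (U - W)) = x ^ card U"
      using assms by (metis (no_types, lifting) card_Diff_subset card_mono finite_subset le_add_diff_inverse mem_Collect_eq)
  qed (use assms in auto)
  then show ?thesis using Pow[of "V - W"] assms by (simp add: power_add sum_distrib_left[symmetric])
qed

text \<open>
  Substituting \<open>x = y / (1 - y)\<close> and clearing the factor \<open>(1 - y) ^ d\<close> turns the products into the
  monomials \<open>y ^ k\<close>.
\<close>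

lemma bernstein_independent:
  fixes g :: "nat \<Rightarrow> real"
  assumes "\<And>x. (\<Sum>k\<le>d. g k * (x ^ k * (1 + x) ^ (d - k))) = 0" "k \<le> d"
  shows "g k = 0"
proof (rule ccontr)
  assume "g k \<noteq> 0"
  then have "finite {y. (\<Sum>k\<le>d. g k * y ^ k) = 0}"
    using polyfun_finite_roots[of g d] assms(2) by auto
  moreover have "- {1} \<subseteq> {y. (\<Sum>k\<le>d. g k * y ^ k) = 0}"
  proof clarify
    fix y :: real assume y: "y \<noteq> 1"
    have "(\<Sum>k\<le>d. g k * ((y / (1 - y)) ^ k * (1 + y / (1 - y)) ^ (d - k))) = (\<Sum>k\<le>d. g k * y ^ k / (1 - y) ^ d)"
    proof (rule sum.cong[OF refl])
      fix k assume "k \<in> {..d}"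
      then have "(1 - y) ^ d = (1 - y) ^ k * (1 - y) ^ (d - k)" by (simp flip: power_add)
      moreover have "1 + y / (1 - y) = 1 / (1 - y)" using y by (simp add: field_simps)
      ultimately show "g k * ((y / (1 - y)) ^ k * (1 + y / (1 - y)) ^ (d - k)) = g k * y ^ k / (1 - y) ^ d"
        by (simp add: power_divide)
    qed
    then have "(\<Sum>k\<le>d. g k * y ^ k) / (1 - y) ^ d = 0" using assms(1) by (simp add: sum_divide_distrib)
    then show "(\<Sum>k\<le>d. g k * y ^ k) = 0" using y by simp
  qed
  ultimately have "finite (- {1::real})" by (rule rev_finite_subset)
  then show False using infinite_UNIV_char_0 finite_compl[of "{1::real}"] by auto
qed

text \<open>
  With \<open>M = {}\<close> the last condition just says that \<open>U\<close> is non-empty, so basic tiles and tiles with a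
  Morse face are covered by one formula.
\<close>

definition tile_faces :: "'v set \<Rightarrow> 'v set \<Rightarrow> 'v set \<Rightarrow> 'v set set" where
  "tile_faces W V M = {U. W \<subseteq> U \<and> U \<subseteq> V \<and> \<not> U \<subseteq> M}"

text \<open>
  The combinatorial content of a tiling of a \<open>(d - 1)\<close>-manifold: an abstract simplicial complex (of
  non-empty simplices) in which stars have the Euler characteristic of a manifold point, partitioned
  into the face sets of tiles.
\<close>

locale tiled_complex =
  fixes KK :: "'v set set" and I :: "'t set" and V W M :: "'t \<Rightarrow> 'v set" and d :: nat
  assumes finite_complex: "finite KK"
    and finite_simplex: "\<sigma> \<in> KK \<Longrightarrow> finite \<sigma>"
    and nonempty_simplex: "\<sigma> \<in> KK \<Longrightarrow> \<sigma> \<noteq> {}"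
    and face_closed: "\<sigma> \<in> KK \<Longrightarrow> \<rho> \<subseteq> \<sigma> \<Longrightarrow> \<rho> \<noteq> {} \<Longrightarrow> \<rho> \<in> KK"
    and star_euler: "\<sigma> \<in> KK \<Longrightarrow> (\<Sum>\<rho> | \<rho> \<in> KK \<and> \<sigma> \<subseteq> \<rho>. (-1) ^ card \<rho>) = ((-1) ^ d :: real)"
    and finite_tiles: "finite I"
    and dim_ge: "d \<ge> 2"
    and card_tile: "i \<in> I \<Longrightarrow> card (V i) = d"
    and restriction_subset: "i \<in> I \<Longrightarrow> W i \<subseteq> V i"
    and morse_face: "i \<in> I \<Longrightarrow> M i \<noteq> {} \<Longrightarrow>
           W i \<noteq> {} \<and> W i \<subseteq> M i \<and> M i \<subseteq> V i \<and> card (M i) + 2 \<le> d"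
    and tiles_cover: "KK = (\<Union>i\<in>I. tile_faces (W i) (V i) (M i))"
    and tiles_disjoint: "disjoint_family_on (\<lambda>i. tile_faces (W i) (V i) (M i)) I"
begin

definition h :: "nat \<Rightarrow> nat" where
  "h k = card {i \<in> I. card (W i) = k}"

text \<open>
  In terms of vertex sets the tiles of order \<open>0\<close> and \<open>d\<close> are critical of index \<open>0\<close> and \<open>d - 1\<close>; a tile of
  order \<open>k\<close> with \<open>0 < k < d - 1\<close> is critical if its Morse face has \<open>k\<close> vertices, that is if \<open>M = W\<close>.
\<close>

definition c :: "nat \<Rightarrow> nat" where
  "c k = (if k = 0 then h 0 else if k = d - 1 then h d else card {i \<in> I. card (W i) = k \<and> M i = W i})"

lemma c_ends: "c 0 = h 0" "c (d - 1) = h d"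
  using dim_ge by (auto simp: c_def)

lemma finite_V: "i \<in> I \<Longrightarrow> finite (V i)"
  using card_tile dim_ge by (metis card.infinite not_numeral_le_zero)

lemma finite_W: "i \<in> I \<Longrightarrow> finite (W i)"
  using finite_V restriction_subset finite_subset by blast

lemma card_W_le: "i \<in> I \<Longrightarrow> card (W i) \<le> d"
  using card_mono[OF finite_V restriction_subset] card_tile by metis

lemma card_M_le: "i \<in> I \<Longrightarrow> card (M i) + 2 \<le> d"
  using morse_face dim_ge by (cases "M i = {}") auto

lemma finite_M: "i \<in> I \<Longrightarrow> finite (M i)"
  using morse_face finite_V finite_subset by (metis finite.emptyI)

lemma sum_over_tiles:
  fixes \<phi> :: "nat \<Rightarrow> real"
  shows "(\<Sum>i\<in>I. \<phi> (card (W i))) = (\<Sum>k\<le>d. real (h k) * \<phi> k)"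
proof -
  have "(\<Sum>i\<in>I. \<phi> (card (W i))) = (\<Sum>k\<le>d. \<Sum>i | i \<in> I \<and> card (W i) = k. \<phi> (card (W i)))"
    using card_W_le by (intro sum.group[symmetric] finite_tiles) auto
  also have "\<dots> = (\<Sum>k\<le>d. real (h k) * \<phi> k)"
    by (rule sum.cong) (auto simp: h_def)
  finally show ?thesis .
qed

lemma sum_over_faces:
  fixes \<phi> :: "nat \<Rightarrow> real"
  shows "(\<Sum>\<sigma>\<in>KK. \<phi> (card \<sigma>)) = (\<Sum>i\<in>I. \<Sum>U\<in>tile_faces (W i) (V i) (M i). \<phi> (card U))"
proof -
  have "finite (tile_faces (W i) (V i) (M i))" if "i \<in> I" for i
    using finite_V[OF that] by (auto simp: tile_faces_def intro: finite_subset[of _ "Pow (V i)"])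
  then show ?thesis
    using tiles_disjoint finite_tiles unfolding disjoint_family_on_def
    by (subst tiles_cover) (intro sum.UNION_disjoint, auto)
qed

text \<open>
  Sum the star condition over all simplices \<open>\<sigma>\<close>, weighted by \<open>\<phi> (card \<sigma>)\<close>, and exchange the summations.
\<close>

lemma weighted_dehn_sommerville:
  fixes \<phi> :: "nat \<Rightarrow> real"
  shows "(\<Sum>\<rho>\<in>KK. (-1) ^ card \<rho> * (\<Sum>\<sigma>\<in>Pow \<rho> - {{}}. \<phi> (card \<sigma>))) = (-1) ^ d * (\<Sum>\<sigma>\<in>KK. \<phi> (card \<sigma>))"
proof -
  have "(\<Sum>\<rho>\<in>KK. (-1) ^ card \<rho> * (\<Sum>\<sigma>\<in>Pow \<rho> - {{}}. \<phi> (card \<sigma>)))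
      = (\<Sum>\<rho>\<in>KK. \<Sum>\<sigma> | \<sigma> \<in> KK \<and> \<sigma> \<subseteq> \<rho>. (-1) ^ card \<rho> * \<phi> (card \<sigma>))"
  proof (rule sum.cong[OF refl])
    fix \<rho> assume "\<rho> \<in> KK"
    then have "Pow \<rho> - {{}} = {\<sigma>. \<sigma> \<in> KK \<and> \<sigma> \<subseteq> \<rho>}" using face_closed nonempty_simplex by auto
    then show "(-1) ^ card \<rho> * (\<Sum>\<sigma>\<in>Pow \<rho> - {{}}. \<phi> (card \<sigma>))
        = (\<Sum>\<sigma> | \<sigma> \<in> KK \<and> \<sigma> \<subseteq> \<rho>. (-1) ^ card \<rho> * \<phi> (card \<sigma>))" by (simp add: sum_distrib_left)
  qed
  also have "\<dots> = (\<Sum>\<sigma>\<in>KK. \<Sum>\<rho> | \<rho> \<in> KK \<and> \<sigma> \<subseteq> \<rho>. (-1) ^ card \<rho> * \<phi> (card \<sigma>))"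
    by (rule sum.swap_restrict[OF finite_complex finite_complex])
  also have "\<dots> = (\<Sum>\<sigma>\<in>KK. (-1) ^ d * \<phi> (card \<sigma>))"
    by (rule sum.cong) (simp_all add: star_euler flip: sum_distrib_right)
  finally show ?thesis by (simp add: sum_distrib_left)
qed

lemma sum_nonempty_subsets:
  fixes x :: real
  assumes "finite \<rho>"
  shows "(\<Sum>\<sigma>\<in>Pow \<rho> - {{}}. x ^ card \<sigma>) = (1 + x) ^ card \<rho> - 1"
proof -
  have "Pow \<rho> = {U. {} \<subseteq> U \<and> U \<subseteq> \<rho>}" by auto
  then have "(\<Sum>\<sigma>\<in>Pow \<rho>. x ^ card \<sigma>) = (1 + x) ^ card \<rho>"
    using sum_interval_power_card[OF assms empty_subsetI, of x] by simp
  then show ?thesis using assms by (simp add: sum_diff1)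
qed

text \<open>
  The correction \<open>h 0\<close> accounts for the empty face, which belongs to the interval of each tile of order
  \<open>0\<close> but is not a simplex of the complex.
\<close>

lemma basic_face_polynomial:
  assumes basic: "\<And>i. i \<in> I \<Longrightarrow> M i = {}"
  shows "(\<Sum>\<sigma>\<in>KK. x ^ card \<sigma>) = (\<Sum>k\<le>d. real (h k) * (x ^ k * (1 + x) ^ (d - k))) - real (h 0)"
proof -
  have "(\<Sum>U\<in>tile_faces (W i) (V i) (M i). x ^ card U)
      = x ^ card (W i) * (1 + x) ^ (d - card (W i)) - of_bool (card (W i) = 0)" if i: "i \<in> I" for i
  proof -
    have eq: "tile_faces (W i) (V i) (M i) = {U. W i \<subseteq> U \<and> U \<subseteq> V i} - {{}}"
      using basic[OF i] by (auto simp: tile_faces_def)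
    have "finite {U. W i \<subseteq> U \<and> U \<subseteq> V i}"
      using finite_V[OF i] by (auto intro: finite_subset[of _ "Pow (V i)"])
    then have "(\<Sum>U\<in>tile_faces (W i) (V i) (M i). x ^ card U)
        = (\<Sum>U | W i \<subseteq> U \<and> U \<subseteq> V i. x ^ card U) - of_bool (card (W i) = 0)"
      unfolding eq using finite_W[OF i] by (simp add: sum_diff1)
    then show ?thesis
      using sum_interval_power_card[OF finite_V[OF i] restriction_subset[OF i], of x]
        card_Diff_subset[OF finite_W[OF i] restriction_subset[OF i]] card_tile[OF i] by simp
  qed
  then have "(\<Sum>\<sigma>\<in>KK. x ^ card \<sigma>) =
      (\<Sum>i\<in>I. x ^ card (W i) * (1 + x) ^ (d - card (W i)) - of_bool (card (W i) = 0))"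
    unfolding sum_over_faces[of "\<lambda>j. x ^ j"] by simp
  also have "\<dots> = (\<Sum>k\<le>d. real (h k) * (x ^ k * (1 + x) ^ (d - k) - of_bool (k = 0)))"
    by (rule sum_over_tiles[of "\<lambda>k. x ^ k * (1 + x) ^ (d - k) - of_bool (k = 0)"])
  also have "\<dots> = (\<Sum>k\<le>d. real (h k) * (x ^ k * (1 + x) ^ (d - k))) - (\<Sum>k\<le>d. if k = 0 then real (h k) else 0)"
    unfolding sum_subtractf[symmetric] by (rule sum.cong) (auto simp: algebra_simps)
  finally show ?thesis by simp
qed

text \<open>
  Under \<open>x \<mapsto> - 1 - x\<close> the polynomial \<open>F\<close> reproduces itself up to sign and constant, while the sum over
  tiles has its coefficients reversed.  The two together leave a constant linear combination of the
  products \<open>x ^ k * (1 + x) ^ (d - k)\<close>; its value at \<open>0\<close> is \<open>h d - h 0\<close>.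
\<close>

theorem basic_tiling_h_symmetric:
  assumes basic: "\<And>i. i \<in> I \<Longrightarrow> M i = {}" and "h 0 = h d" and "k \<le> d"
  shows "h k = h (d - k)"
proof -
  define F where "F x = (\<Sum>\<sigma>\<in>KK. x ^ card \<sigma>)" for x :: real
  define G where "G x = (\<Sum>k\<le>d. real (h k) * (x ^ k * (1 + x) ^ (d - k)))" for x :: real
  define R where "R x = (\<Sum>k\<le>d. real (h (d - k)) * (x ^ k * (1 + x) ^ (d - k)))" for x :: real
  have FG: "F x = G x - real (h 0)" for x
    unfolding F_def G_def by (rule basic_face_polynomial[OF basic])
  have F_reflect: "F (- 1 - x) - F (- 1) = (-1) ^ d * F x" for x
  proof -
    have "(-1) ^ d * F x = (\<Sum>\<rho>\<in>KK. (-1) ^ card \<rho> * ((1 + x) ^ card \<rho> - 1))"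
      unfolding F_def weighted_dehn_sommerville[of "\<lambda>j. x ^ j", symmetric]
      by (rule sum.cong) (simp_all add: sum_nonempty_subsets finite_simplex)
    also have "\<dots> = F (- 1 - x) - F (- 1)"
      unfolding F_def sum_subtractf[symmetric]
    proof (rule sum.cong[OF refl])
      fix \<rho> :: "'v set"
      have "(- 1 - x) ^ card \<rho> = (-1) ^ card \<rho> * (1 + x) ^ card \<rho>" 
        unfolding power_mult_distrib[symmetric] by simp
      then show "(-1) ^ card \<rho> * ((1 + x) ^ card \<rho> - 1) = (- 1 - x) ^ card \<rho> - (- 1) ^ card \<rho>"
        by (simp add: algebra_simps)
    qed
    finally show ?thesis by simp
  qed
  have G_reflect: "G (- 1 - x) = (-1) ^ d * R x" for x
  proof -
    have "G (- 1 - x) = (\<Sum>k\<le>d. real (h (d - k)) * ((- 1 - x) ^ (d - k) * (- x) ^ (d - (d - k))))"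
      unfolding G_def atMost_atLeast0
      by (subst sum.atLeastAtMost_rev[of _ 0 d]) simp
    also have "\<dots> = (\<Sum>k\<le>d. (-1) ^ d * (real (h (d - k)) * (x ^ k * (1 + x) ^ (d - k))))"
    proof (rule sum.cong[OF refl])
      fix k assume "k \<in> {..d}"
      then have k: "k \<le> d" by simp
      have "(- 1 - x) ^ (d - k) = (-1) ^ (d - k) * (1 + x) ^ (d - k)" "(- x) ^ k = (-1) ^ k * x ^ k"
        unfolding power_mult_distrib[symmetric] by simp_all
      moreover have "(-1) ^ d = (-1) ^ (d - k) * ((-1) ^ k :: real)" using k by (simp flip: power_add)
      ultimately show "real (h (d - k)) * ((- 1 - x) ^ (d - k) * (- x) ^ (d - (d - k)))
          = (-1) ^ d * (real (h (d - k)) * (x ^ k * (1 + x) ^ (d - k)))" using k by simp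
    qed
    finally show ?thesis unfolding R_def by (simp add: sum_distrib_left)
  qed
  have pm: "(-1) ^ d * ((-1) ^ d * z) = z" for z :: real
    by (simp add: mult.assoc[symmetric] flip: power_mult_distrib)
  have "R x - G x = R 0 - G 0" for x
  proof -
    have "(-1) ^ d * (R y - G y) = F (- 1) + real (h 0) - (-1) ^ d * real (h 0)" for y
      using F_reflect[of y] unfolding FG[of "- 1 - y"] FG[of y] G_reflect by (simp add: algebra_simps)
    then have "(-1) ^ d * (R x - G x) = (-1) ^ d * (R 0 - G 0)" by metis
    then show ?thesis using pm by metis
  qed
  moreover have "R 0 = real (h d)" "G 0 = real (h 0)"
  proof -
    have "R 0 = (\<Sum>k\<le>d. if k = 0 then real (h (d - k)) else 0)" "G 0 = (\<Sum>k\<le>d. if k = 0 then real (h k) else 0)"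
      unfolding R_def G_def by (intro sum.cong; simp)+
    then show "R 0 = real (h d)" "G 0 = real (h 0)" by simp_all
  qed
  ultimately have "(\<Sum>k\<le>d. (real (h (d - k)) - real (h k)) * (x ^ k * (1 + x) ^ (d - k))) = 0" for x
    using assms(2) unfolding R_def G_def by (simp add: sum_subtractf left_diff_distrib)
  from bernstein_independent[OF this assms(3)] show ?thesis by simp
qed

text \<open>
  The weight that singles out facets gives \<open>2 * f (d - 1) = d * f d\<close> for the numbers of simplices with
  \<open>d - 1\<close> and \<open>d\<close> vertices.  A tile of order \<open>k\<close> has one top simplex and \<open>d - k\<close> facets, whatever its Morse
  face, because the Morse face has codimension at least two.
\<close>

lemma facet_identity: "(\<Sum>k\<le>d. real (h k) * (real d - 2 * real k)) = 0"
proof -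
  define a where "a j = (\<Sum>\<sigma>\<in>KK. of_bool (card \<sigma> = j) :: real)" for j
  have card_le: "card \<rho> \<le> d" if \<rho>: "\<rho> \<in> KK" for \<rho>
  proof -
    obtain i where "i \<in> I" "\<rho> \<subseteq> V i" using \<rho> by (subst (asm) tiles_cover) (auto simp: tile_faces_def)
    then show ?thesis using card_mono[OF finite_V] card_tile by metis
  qed
  have "(-1) ^ d * a (d - 1) = (\<Sum>\<rho>\<in>KK. (-1) ^ card \<rho> * (\<Sum>\<sigma>\<in>Pow \<rho> - {{}}. of_bool (card \<sigma> = d - 1)))"
    unfolding a_def by (rule weighted_dehn_sommerville[of "\<lambda>j. of_bool (j = d - 1)", symmetric])
  also have "\<dots> = (\<Sum>\<rho>\<in>KK. (-1) ^ d * (real d * of_bool (card \<rho> = d) - of_bool (card \<rho> = d - 1)))"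
  proof (rule sum.cong[OF refl])
    fix \<rho> assume \<rho>: "\<rho> \<in> KK"
    have fin: "finite (Pow \<rho> - {{}})" using finite_simplex[OF \<rho>] by simp
    have "(\<Sum>\<sigma>\<in>Pow \<rho> - {{}}. of_bool (card \<sigma> = d - 1) :: real) = real (card {\<sigma> \<in> Pow \<rho> - {{}}. card \<sigma> = d - 1})"
      using fin by (simp add: Int_def)
    also have "{\<sigma> \<in> Pow \<rho> - {{}}. card \<sigma> = d - 1} = {\<sigma>. \<sigma> \<subseteq> \<rho> \<and> card \<sigma> = d - 1}" using dim_ge by auto
    also have "card \<dots> = card \<rho> choose (d - 1)" by (rule n_subsets[OF finite_simplex[OF \<rho>]])
    finally have s: "(\<Sum>\<sigma>\<in>Pow \<rho> - {{}}. of_bool (card \<sigma> = d - 1) :: real) = real (card \<rho> choose (d - 1))" .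
    obtain e where e: "d = Suc e" using dim_ge by (cases d) auto
    consider "card \<rho> = Suc e" | "card \<rho> = e" | "card \<rho> < e" using card_le[OF \<rho>] e by linarith
    then show "(-1) ^ card \<rho> * (\<Sum>\<sigma>\<in>Pow \<rho> - {{}}. of_bool (card \<sigma> = d - 1)) =
        (-1) ^ d * (real d * of_bool (card \<rho> = d) - of_bool (card \<rho> = d - 1))"
      unfolding s by cases (auto simp: e)
  qed
  also have "\<dots> = (-1) ^ d * (real d * a d - a (d - 1))"
    by (simp add: a_def sum_distrib_left sum_subtractf right_diff_distrib)
  finally have 1: "2 * a (d - 1) = real d * a d" by simp
  have "a d = (\<Sum>i\<in>I. 1)"
    unfolding a_def sum_over_faces[of "\<lambda>j. of_bool (j = d)"]
  proof (rule sum.cong[OF refl])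
    fix i assume i: "i \<in> I"
    have "{U \<in> tile_faces (W i) (V i) (M i). card U = d} = {V i}"
      using card_tile[OF i] restriction_subset[OF i] card_subset_eq[OF finite_V[OF i]] card_M_le[OF i]
        card_mono[OF finite_M[OF i], of "V i"] by (auto simp: tile_faces_def)
    moreover have "finite (tile_faces (W i) (V i) (M i))"
      using finite_V[OF i] by (auto simp: tile_faces_def intro: finite_subset[of _ "Pow (V i)"])
    ultimately show "(\<Sum>U\<in>tile_faces (W i) (V i) (M i). of_bool (card U = d)) = (1::real)"
      by (simp add: Int_def)
  qed
  moreover have "a (d - 1) = (\<Sum>i\<in>I. real d - real (card (W i)))"
    unfolding a_def sum_over_faces[of "\<lambda>j. of_bool (j = d - 1)"]
  proof (rule sum.cong[OF refl])
    fix i assume i: "i \<in> I"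
    have "{U \<in> tile_faces (W i) (V i) (M i). card U = d - 1} = (\<lambda>v. V i - {v}) ` (V i - W i)"
    proof (intro equalityI subsetI)
      fix U assume "U \<in> {U \<in> tile_faces (W i) (V i) (M i). card U = d - 1}"
      then have U: "W i \<subseteq> U" "U \<subseteq> V i" "card U = d - 1" by (auto simp: tile_faces_def)
      have "card (V i - U) = 1"
        using U card_Diff_subset[OF finite_subset[OF U(2) finite_V[OF i]] U(2)] card_tile[OF i] dim_ge by simp
      then obtain v where "V i - U = {v}" by (auto simp: card_1_singleton_iff)
      then show "U \<in> (\<lambda>v. V i - {v}) ` (V i - W i)" using U by (intro image_eqI[of _ _ v]) auto
    next
      fix U assume "U \<in> (\<lambda>v. V i - {v}) ` (V i - W i)"
      then obtain v where v: "v \<in> V i" "v \<notin> W i" "U = V i - {v}" by auto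
      then have cU: "card U = d - 1" using card_tile[OF i] by simp
      have "\<not> U \<subseteq> M i"
      proof
        assume "U \<subseteq> M i"
        then have "card U \<le> card (M i)" by (rule card_mono[OF finite_M[OF i]])
        then show False using cU card_M_le[OF i] by linarith
      qed
      with cU show "U \<in> {U \<in> tile_faces (W i) (V i) (M i). card U = d - 1}"
        using v restriction_subset[OF i] by (auto simp: tile_faces_def)
    qed
    moreover have "inj_on (\<lambda>v. V i - {v}) (V i - W i)" by (auto simp: inj_on_def)
    ultimately have "card {U \<in> tile_faces (W i) (V i) (M i). card U = d - 1} = d - card (W i)"
      using card_Diff_subset[OF finite_W[OF i] restriction_subset[OF i]] card_tile[OF i] by (simp add: card_image)
    moreover have "finite (tile_faces (W i) (V i) (M i))"
      using finite_V[OF i] by (auto simp: tile_faces_def intro: finite_subset[of _ "Pow (V i)"])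
    ultimately show "(\<Sum>U\<in>tile_faces (W i) (V i) (M i). of_bool (card U = d - 1)) = real d - real (card (W i))"
      using card_W_le[OF i] by (simp add: Int_def of_nat_diff)
  qed
  ultimately have "(\<Sum>i\<in>I. real d - 2 * real (card (W i))) = 0"
    using 1 by (simp add: sum_subtractf sum_distrib_left[symmetric] mult.commute)
  then show ?thesis using sum_over_tiles[of "\<lambda>k. real d - 2 * real k"] by simp
qed

text \<open>
  For even \<open>d\<close> the weight \<open>(-1) ^ card \<sigma>\<close> gives \<open>E = - E\<close> for the alternating number \<open>E\<close> of simplices.  The
  interval between \<open>W\<close> and \<open>V\<close> contributes to \<open>E\<close> only if \<open>W = V\<close>, the interval between \<open>W\<close> and \<open>M\<close> that is
  missing from the tile only if \<open>W = M\<close>; these are the critical tiles.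
\<close>

lemma euler_identity:
  assumes "even d"
  shows "real (h d) = (\<Sum>i | i \<in> I \<and> M i = W i. (-1) ^ card (W i))"
proof -
  define E where "E = (\<Sum>\<sigma>\<in>KK. (-1) ^ card \<sigma> :: real)"
  have "E = (\<Sum>\<rho>\<in>KK. (-1) ^ card \<rho> * (\<Sum>\<sigma>\<in>Pow \<rho> - {{}}. (-1) ^ card \<sigma>))"
    using weighted_dehn_sommerville[of "\<lambda>j. (-1) ^ j"] assms by (simp add: E_def)
  also have "\<dots> = - E"
    unfolding E_def sum_negf[symmetric]
    by (rule sum.cong) (auto simp: sum_nonempty_subsets finite_simplex nonempty_simplex card_gt_0_iff power_0_left)
  finally have E: "E = 0" by simp
  have fin: "finite {U. A \<subseteq> U \<and> U \<subseteq> B}" if "finite B" for A B :: "'v set"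
    using that by (auto intro: finite_subset[of _ "Pow B"])
  have int: "(\<Sum>U | A \<subseteq> U \<and> U \<subseteq> B. (-1) ^ card U) = of_bool (A = B) * (-1 :: real) ^ card A"
    if "finite B" "A \<subseteq> B" for A B :: "'v set"
    using sum_interval_power_card[OF that, of "-1 :: real"] that by (auto simp: power_0_left)
  have "(\<Sum>U\<in>tile_faces (W i) (V i) (M i). (-1) ^ card U)
      = of_bool (card (W i) = d) - of_bool (M i = W i) * (-1 :: real) ^ card (W i)" if i: "i \<in> I" for i
  proof -
    have Wd: "W i = V i \<longleftrightarrow> card (W i) = d"
      using card_tile[OF i] card_subset_eq[OF finite_V[OF i] restriction_subset[OF i]] by auto
    have MV: "M i \<subseteq> V i" using morse_face[OF i] by (cases "M i = {}") auto
    have "tile_faces (W i) (V i) (M i) = {U. W i \<subseteq> U \<and> U \<subseteq> V i} - {U. W i \<subseteq> U \<and> U \<subseteq> M i}"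
      by (auto simp: tile_faces_def)
    then have "(\<Sum>U\<in>tile_faces (W i) (V i) (M i). (-1) ^ card U)
       = (\<Sum>U | W i \<subseteq> U \<and> U \<subseteq> V i. (-1) ^ card U) - (\<Sum>U | W i \<subseteq> U \<and> U \<subseteq> M i. (-1 :: real) ^ card U)"
      using MV by (simp only:) (rule sum_diff[OF fin[OF finite_V[OF i]]], blast)
    also have "(\<Sum>U | W i \<subseteq> U \<and> U \<subseteq> V i. (-1 :: real) ^ card U) = of_bool (card (W i) = d)"
      using int[OF finite_V[OF i] restriction_subset[OF i]] Wd assms by auto
    also have "(\<Sum>U | W i \<subseteq> U \<and> U \<subseteq> M i. (-1 :: real) ^ card U) = of_bool (M i = W i) * (-1) ^ card (W i)"
    proof (cases "W i \<subseteq> M i")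
      case True
      then show ?thesis using int[OF finite_M[OF i] True] by auto
    next
      case False
      then have eq: "{U. W i \<subseteq> U \<and> U \<subseteq> M i} = {}" "M i \<noteq> W i" by auto
      show ?thesis unfolding eq(1) using eq(2) by simp
    qed
    finally show ?thesis .
  qed
  then have "E = (\<Sum>i\<in>I. of_bool (card (W i) = d) - of_bool (M i = W i) * (-1) ^ card (W i))"
    unfolding E_def sum_over_faces[of "\<lambda>j. (-1) ^ j"] by simp
  also have "\<dots> = real (h d) - (\<Sum>i\<in>I. of_bool (M i = W i) * (-1) ^ card (W i))"
    using finite_tiles by (simp add: sum_subtractf h_def Int_def)
  also have "(\<Sum>i\<in>I. of_bool (M i = W i) * (-1) ^ card (W i)) = (\<Sum>i | i \<in> I \<and> M i = W i. (-1 :: real) ^ card (W i))"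
    using finite_tiles by (intro sum.mono_neutral_cong_right) auto
  finally show ?thesis using E by simp
qed

theorem basic_palindromic_iff:
  assumes basic: "\<And>i. i \<in> I \<Longrightarrow> M i = {}"
  shows "palindromic d h \<longleftrightarrow> palindromic (d - 1) c"
proof -
  have c0: "c k = 0" if "k \<noteq> 0" "k \<noteq> d - 1" for k
  proof -
    have "{i \<in> I. card (W i) = k \<and> M i = W i} = {}" using that(1) basic by force
    then have "card {i \<in> I. card (W i) = k \<and> M i = W i} = 0" by (simp only: card.empty)
    then show ?thesis using that by (simp add: c_def)
  qed
  have "palindromic (d - 1) c \<longleftrightarrow> h 0 = h d"
  proof
    assume "palindromic (d - 1) c"
    then have "c 0 = c (d - 1)" unfolding palindromic_def by (metis diff_zero zero_le)
    then show "h 0 = h d" using dim_ge by (auto simp: c_def)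
  next
    assume eq: "h 0 = h d"
    show "palindromic (d - 1) c"
      unfolding palindromic_def
    proof (intro allI impI)
      fix k assume "k \<le> d - 1"
      then consider "k = 0" | "k = d - 1" | "k \<noteq> 0" "k \<noteq> d - 1" "d - 1 - k \<noteq> 0" "d - 1 - k \<noteq> d - 1" by fastforce
      then show "c k = c (d - 1 - k)" using eq dim_ge c0 by cases (auto simp: c_def)
    qed
  qed
  moreover have "palindromic d h \<longleftrightarrow> h 0 = h d"
    using basic_tiling_h_symmetric[OF basic] unfolding palindromic_def by (metis diff_zero zero_le)
  ultimately show ?thesis by simp
qed

text \<open>
  For \<open>d = 2\<close> both sides say \<open>h 0 = h 2\<close>.  For \<open>d = 3\<close> and \<open>d = 4\<close> the facet identity links \<open>h 0 - h d\<close> with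
  \<open>h 1 - h (d - 1)\<close>, and for \<open>d = 4\<close> the Euler identity links \<open>c 0 - c 3\<close> with \<open>c 1 - c 2\<close>.
\<close>

theorem low_dimension_palindromic_iff:
  assumes "d \<le> 4"
  shows "palindromic d h \<longleftrightarrow> palindromic (d - 1) c"
proof -
  consider "d = 2" | "d = 3" | "d = 4" using assms dim_ge by linarith
  then show ?thesis
  proof cases
    assume d: "d = 2"
    have "palindromic 2 v \<longleftrightarrow> v 0 = v 2" "palindromic 1 v \<longleftrightarrow> v 0 = v 1" for v
      by (auto simp: palindromic_def le_Suc_eq numeral_2_eq_2)
    then show ?thesis using d c_ends by simp
  next
    assume d: "d = 3"
    have "palindromic 3 v \<longleftrightarrow> v 0 = v 3 \<and> v 1 = v 2" "palindromic 2 v \<longleftrightarrow> v 0 = v 2" for v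
      by (auto simp: palindromic_def le_Suc_eq numeral_2_eq_2 numeral_3_eq_3)
    moreover have "3 * real (h 0) + real (h 1) = real (h 2) + 3 * real (h 3)"
      using facet_identity unfolding d by (simp add: eval_nat_numeral)
    ultimately show ?thesis using d c_ends by auto
  next
    assume d: "d = 4"
    have pal: "palindromic 4 v \<longleftrightarrow> v 0 = v 4 \<and> v 1 = v 3" "palindromic 3 v \<longleftrightarrow> v 0 = v 3 \<and> v 1 = v 2" for v
      by (auto simp: palindromic_def le_Suc_eq eval_nat_numeral)
    have 1: "4 * real (h 0) + 2 * real (h 1) = 2 * real (h 3) + 4 * real (h 4)"
      using facet_identity unfolding d by (simp add: eval_nat_numeral)
    let ?J = "{i. i \<in> I \<and> M i = W i}"
    have "real (h 4) = (\<Sum>i\<in>?J. (-1) ^ card (W i))"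
      using euler_identity unfolding d by simp
    also have "\<dots> = (\<Sum>k\<le>2. \<Sum>i | i \<in> ?J \<and> card (W i) = k. (-1) ^ card (W i))"
      using finite_tiles card_M_le d by (intro sum.group[symmetric]) force+
    also have "\<dots> = (\<Sum>k\<le>2. real (card {i \<in> ?J. card (W i) = k}) * (-1) ^ k)"
      by (rule sum.cong) auto
    also have "\<dots> = real (card {i \<in> ?J. card (W i) = 0}) - real (card {i \<in> ?J. card (W i) = 1})
        + real (card {i \<in> ?J. card (W i) = 2})" by (simp add: numeral_2_eq_2)
    also have "{i \<in> ?J. card (W i) = 0} = {i \<in> I. card (W i) = 0}"
    proof -
      have "M i = {}" if "i \<in> I" "W i = {}" for i using morse_face that by blast
      then show ?thesis using finite_W by auto
    qed
    also have "card {i \<in> I. card (W i) = 0} = c 0" by (simp add: c_ends h_def)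
    also have "{i \<in> ?J. card (W i) = 1} = {i \<in> I. card (W i) = 1 \<and> M i = W i}" by auto
    also have "card \<dots> = c 1" unfolding c_def using d by simp
    also have "{i \<in> ?J. card (W i) = 2} = {i \<in> I. card (W i) = 2 \<and> M i = W i}" by auto
    also have "card \<dots> = c 2" unfolding c_def using d by simp
    finally have "real (h 4) = real (c 0) - real (c 1) + real (c 2)" .
    then show ?thesis using 1 pal d c_ends by auto
  qed
qed

end


section \<open>Tiles as vertex data\<close>

text \<open>
  \<open>W\<close> holds the vertices opposite to the removed facets, \<open>M\<close> the vertices of the Morse face.  The Morse
  face lies in none of the removed facets exactly if \<open>M\<close> contains all of \<open>W\<close>.
\<close>

definition tile_data :: "'a::euclidean_space set \<Rightarrow> 'a set \<Rightarrow> 'a set \<Rightarrow> 'a set \<Rightarrow> bool" where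
  "tile_data \<sigma> W M T \<longleftrightarrow>
     W \<subseteq> vertices \<sigma> \<and> M \<subseteq> vertices \<sigma> \<and>
     T = \<sigma> - (\<Union>v\<in>W. convex hull (vertices \<sigma> - {v})) - convex hull M \<and>
     (M \<noteq> {} \<longrightarrow> W \<noteq> {} \<and> W \<subseteq> M \<and> card M + 2 \<le> card (vertices \<sigma>))"

lemma inj_on_convex_hull_subsets:
  fixes V :: "'a::euclidean_space set"
  assumes "\<not> affine_dependent V"
  shows "inj_on (\<lambda>U. convex hull U) (Pow V)"
proof (rule inj_on_inverseI)
  fix U assume "U \<in> Pow V"
  then show "vertices (convex hull U) = U"
    using assms affine_dependent_subset by (intro vertices_convex_hull) blast
qed

lemma aff_dim_hull_subset:
  fixes V :: "'a::euclidean_space set"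
  assumes "\<not> affine_dependent V" "U \<subseteq> V"
  shows "aff_dim (convex hull U) = int (card U) - 1"
proof -
  have "\<not> affine_dependent U" using assms affine_dependent_subset by blast
  then show ?thesis by (simp add: aff_dim_convex_hull aff_dim_affine_independent)
qed

lemma facets_simplex:
  assumes "m simplex \<sigma>"
  shows "facets \<sigma> = (\<lambda>v. convex hull (vertices \<sigma> - {v})) ` vertices \<sigma>"
proof -
  let ?V = "vertices \<sigma>"
  note s = simplex_vertices[OF assms]
  have dim: "aff_dim \<sigma> = int (card ?V) - 1" using aff_dim_hull_subset[OF s(1) subset_refl] s(4) by simp
  have "F \<in> facets \<sigma> \<longleftrightarrow> (\<exists>v\<in>?V. F = convex hull (?V - {v}))" for F
  proof
    assume "F \<in> facets \<sigma>"
    then have F: "F face_of convex hull ?V" "aff_dim F = aff_dim \<sigma> - 1" by (auto simp: facets_def s(4))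
    then obtain U where U: "U \<subseteq> ?V" "F = convex hull U"
      using face_of_convex_hull_affine_independent[OF s(1)] by blast
    have "int (card U) = int (card ?V) - 1" using F(2) dim aff_dim_hull_subset[OF s(1) U(1)] U(2) by simp
    moreover have "finite U" using U(1) s(2) by (rule finite_subset)
    ultimately have "card (?V - U) = 1"
      using card_Diff_subset[of U ?V] U(1) by simp
    then obtain v where "?V - U = {v}" by (auto simp: card_1_singleton_iff)
    then have "v \<in> ?V" "U = ?V - {v}" using U(1) by auto
    then show "\<exists>v\<in>?V. F = convex hull (?V - {v})" using U(2) by blast
  next
    assume "\<exists>v\<in>?V. F = convex hull (?V - {v})"
    then obtain v where v: "v \<in> ?V" "F = convex hull (?V - {v})" by blast
    have "F face_of convex hull ?V" using face_of_convex_hull_affine_independent[OF s(1)] v(2) by blast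
    moreover have "card ?V = Suc (card (?V - {v}))" using card_Suc_Diff1[OF s(2) v(1)] by simp
    then have "aff_dim F = aff_dim \<sigma> - 1"
      using dim aff_dim_hull_subset[OF s(1), of "?V - {v}"] v(2) by simp
    ultimately show "F \<in> facets \<sigma>" by (simp add: facets_def s(4))
  qed
  then show ?thesis by blast
qed

lemma morse_tile_with_iff:
  assumes m: "int m simplex \<sigma>"
  shows "morse_tile_with \<sigma> m k \<mu> T \<longleftrightarrow> (\<exists>W M. tile_data \<sigma> W M T \<and> card W = k \<and> \<mu> = convex hull M)"
proof -
  let ?V = "vertices \<sigma>"
  let ?F = "\<lambda>v. convex hull (?V - {v})"
  note s = simplex_vertices[OF m]
  have cV: "card ?V = m + 1" using s(3) by linarith
  have inj: "inj_on (\<lambda>U. convex hull U) (Pow ?V)" by (rule inj_on_convex_hull_subsets[OF s(1)])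
  have injF: "inj_on ?F ?V"
  proof (rule inj_onI)
    fix v w assume vw: "v \<in> ?V" "w \<in> ?V" "?F v = ?F w"
    then have "?V - {v} = ?V - {w}" using inj_onD[OF inj vw(3)] by blast
    then show "v = w" using vw by blast
  qed
  have sub: "convex hull M \<subseteq> ?F v \<longleftrightarrow> v \<notin> M" if "M \<subseteq> ?V" "v \<in> ?V" for M v
  proof
    assume "convex hull M \<subseteq> ?F v"
    then have *: "M \<subseteq> convex hull (?V - {v})" using hull_subset[of M convex] by blast
    show "v \<notin> M"
    proof
      assume "v \<in> M"
      then have "v \<in> affine hull (?V - {v})" using * convex_hull_subset_affine_hull by blast
      then show False using s(1) that(2) unfolding affine_dependent_def by blast
    qed
  next
    assume "v \<notin> M"
    then show "convex hull M \<subseteq> ?F v" using that by (intro hull_mono) blast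
  qed
  show ?thesis
  proof
    assume "morse_tile_with \<sigma> m k \<mu> T"
    then obtain R where R: "R \<subseteq> facets \<sigma>" "card R = k" "T = \<sigma> - \<Union>R - \<mu>"
      "\<mu> \<noteq> {} \<longrightarrow> k \<ge> 1 \<and> \<mu> face_of \<sigma> \<and> aff_dim \<mu> \<le> int m - 2 \<and> (\<forall>F\<in>R. \<not> \<mu> \<subseteq> F)"
      unfolding morse_tile_with_def by blast
    define W where "W = {v \<in> ?V. ?F v \<in> R}"
    have RW: "R = ?F ` W" using R(1) unfolding facets_simplex[OF m] W_def by blast
    have WV: "W \<subseteq> ?V" by (auto simp: W_def)
    have cW: "card W = k" using R(2) unfolding RW using card_image[OF inj_on_subset[OF injF WV]] by simp
    have "\<mu> = {} \<or> \<mu> face_of convex hull ?V" using R(4) s(4) by auto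
    then obtain M where M: "M \<subseteq> ?V" "\<mu> = convex hull M"
      using face_of_convex_hull_affine_independent[OF s(1)] by (metis convex_hull_empty empty_subsetI)
    have "W \<noteq> {} \<and> W \<subseteq> M \<and> card M + 2 \<le> card ?V" if "M \<noteq> {}"
    proof -
      have "\<mu> \<noteq> {}" using that M(2) by simp
      then have \<mu>: "k \<ge> 1" "aff_dim \<mu> \<le> int m - 2" "\<forall>F\<in>R. \<not> \<mu> \<subseteq> F" using R(4) by auto
      have "W \<noteq> {}" using \<mu>(1) cW by auto
      moreover have "W \<subseteq> M" using \<mu>(3) sub[OF M(1)] WV unfolding RW M(2) by blast
      moreover have "card M + 2 \<le> card ?V" using \<mu>(2) aff_dim_hull_subset[OF s(1) M(1)] M(2) cV by simp
      ultimately show ?thesis by blast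
    qed
    then have "tile_data \<sigma> W M T" unfolding tile_data_def using WV M R(3) RW by simp
    then show "\<exists>W M. tile_data \<sigma> W M T \<and> card W = k \<and> \<mu> = convex hull M" using cW M(2) by blast
  next
    assume "\<exists>W M. tile_data \<sigma> W M T \<and> card W = k \<and> \<mu> = convex hull M"
    then obtain W M where d: "tile_data \<sigma> W M T" and cW: "card W = k" and \<mu>: "\<mu> = convex hull M" by blast
    have WM: "W \<subseteq> ?V" "M \<subseteq> ?V" using d by (auto simp: tile_data_def)
    have fW: "finite W" using WM(1) s(2) by (rule finite_subset)
    have "?F ` W \<subseteq> facets \<sigma>" unfolding facets_simplex[OF m] using WM by blast
    moreover have "card (?F ` W) = k" using card_image[OF inj_on_subset[OF injF WM(1)]] cW by simp
    moreover have "T = \<sigma> - \<Union>(?F ` W) - \<mu>" using d \<mu> by (simp add: tile_data_def)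
    moreover have "k \<ge> 1 \<and> \<mu> face_of \<sigma> \<and> aff_dim \<mu> \<le> int m - 2 \<and> (\<forall>F\<in>?F ` W. \<not> \<mu> \<subseteq> F)" if "\<mu> \<noteq> {}"
    proof -
      have "M \<noteq> {}" using that \<mu> by auto
      then have M: "W \<noteq> {}" "W \<subseteq> M" "card M + 2 \<le> card ?V" using d by (auto simp: tile_data_def)
      have "k \<ge> 1" using M(1) cW fW by (simp add: Suc_le_eq card_gt_0_iff flip: cW)
      moreover have "\<mu> face_of \<sigma>"
        using face_of_convex_hull_affine_independent[OF s(1)] s(4) WM(2) \<mu> by metis
      moreover have "aff_dim \<mu> \<le> int m - 2"
        using M(3) aff_dim_hull_subset[OF s(1) WM(2)] \<mu> cV by simp
      moreover have "\<forall>F\<in>?F ` W. \<not> \<mu> \<subseteq> F" unfolding \<mu> using sub[OF WM(2)] M(2) WM(1) by blast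
      ultimately show ?thesis by blast
    qed
    ultimately show "morse_tile_with \<sigma> m k \<mu> T" unfolding morse_tile_with_def using m by blast
  qed
qed

lemma tile_meets_rel_interior_iff:
  assumes K: "simplicial_complex K" and s: "\<sigma> \<in> K" and d: "tile_data \<sigma> W M T"
    and r: "\<rho> \<in> K" and b: "b \<in> rel_interior \<rho>"
  shows "b \<in> T \<longleftrightarrow> vertices \<rho> \<in> tile_faces W (vertices \<sigma>) M"
proof -
  have hull: "b \<in> convex hull U \<longleftrightarrow> vertices \<rho> \<subseteq> U" if "U \<subseteq> vertices \<sigma>" for U
    using rel_interior_mem_iff[OF K r complex_hull_face(1)[OF K s that] b]
      complex_subset_iff[OF K r complex_hull_face(1)[OF K s that]] complex_hull_face(2)[OF K s that] by simp
  have WM: "W \<subseteq> vertices \<sigma>" "M \<subseteq> vertices \<sigma>" and T: "T = \<sigma> - (\<Union>v\<in>W. convex hull (vertices \<sigma> - {v})) - convex hull M"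
    using d by (auto simp: tile_data_def)
  have "b \<in> \<sigma> \<longleftrightarrow> vertices \<rho> \<subseteq> vertices \<sigma>"
    using hull[OF subset_refl] complex_vertices(3)[OF K s] by simp
  moreover have "b \<in> convex hull (vertices \<sigma> - {v}) \<longleftrightarrow> vertices \<rho> \<subseteq> vertices \<sigma> - {v}" for v
    by (rule hull) blast
  ultimately show ?thesis unfolding T tile_faces_def using hull[OF WM(2)] WM(1) by auto
qed

text \<open>
  Complements of single vertices are too large to lie in \<open>M\<close>, so they detect \<open>W\<close>; then a non-empty \<open>M\<close> is the largest
  set above \<open>W\<close> that is missing.  For \<open>card V = 1\<close> this fails: a single point is a tile of order \<open>0\<close> and of
  order \<open>1\<close>.
\<close>

lemma tile_faces_inject:
  assumes V: "finite V" "card V \<ge> 2"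
    and A: "W \<subseteq> V" "M \<subseteq> V" "M \<noteq> {} \<Longrightarrow> W \<noteq> {} \<and> W \<subseteq> M \<and> card M + 2 \<le> card V"
    and B: "W' \<subseteq> V" "M' \<subseteq> V" "M' \<noteq> {} \<Longrightarrow> W' \<noteq> {} \<and> W' \<subseteq> M' \<and> card M' + 2 \<le> card V"
    and eq: "tile_faces W V M = tile_faces W' V M'"
  shows "W = W' \<and> M = M'"
proof -
  \<comment> \<open>Stated for both descriptions of the tile at once.\<close>
  have face: "v \<notin> X \<longleftrightarrow> V - {v} \<in> tile_faces X V Y"
    if "v \<in> V" "X \<subseteq> V" "Y \<noteq> {} \<Longrightarrow> X \<noteq> {} \<and> X \<subseteq> Y \<and> card Y + 2 \<le> card V" "Y \<subseteq> V" for v X Y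
  proof -
    have cY: "card Y + 2 \<le> card V" using that(3) V(2) by (cases "Y = {}") auto
    have "\<not> V - {v} \<subseteq> Y"
    proof
      assume "V - {v} \<subseteq> Y"
      then have "card (V - {v}) \<le> card Y" using finite_subset[OF that(4) V(1)] by (intro card_mono)
      then show False using cY card_Suc_Diff1[OF V(1) that(1)] by linarith
    qed
    then show ?thesis using that(2) by (auto simp: tile_faces_def)
  qed
  have W: "W = W'"
  proof (rule equalityI; rule subsetI)
    fix v assume v: "v \<in> W"
    then have "v \<in> V" using A(1) by blast
    then show "v \<in> W'" using face[OF _ A(1) A(3) A(2)] face[OF _ B(1) B(3) B(2)] v eq by blast
  next
    fix v assume v: "v \<in> W'"
    then have "v \<in> V" using B(1) by blast
    then show "v \<in> W" using face[OF _ A(1) A(3) A(2)] face[OF _ B(1) B(3) B(2)] v eq by blast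
  qed
  have "M \<subseteq> M'"
  proof (cases "M = {}")
    case False
    have "M \<notin> tile_faces W' V M'" using eq by (auto simp: tile_faces_def)
    then show ?thesis using A(2) A(3)[OF False] W by (auto simp: tile_faces_def)
  qed simp
  moreover have "M' \<subseteq> M"
  proof (cases "M' = {}")
    case False
    have "M' \<notin> tile_faces W V M" using eq by (auto simp: tile_faces_def)
    then show ?thesis using B(2) B(3)[OF False] W by (auto simp: tile_faces_def)
  qed simp
  ultimately show ?thesis using W by blast
qed

lemma tile_data_top_face:
  assumes K: "simplicial_complex K" and s: "\<sigma> \<in> K" "\<sigma> \<noteq> {}" and d: "tile_data \<sigma> W M T" and b: "b \<in> rel_interior \<sigma>"
  shows "b \<in> T"
proof -
  have d': "W \<subseteq> vertices \<sigma>" "M \<subseteq> vertices \<sigma>" "M \<noteq> {} \<longrightarrow> card M + 2 \<le> card (vertices \<sigma>)"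
    using d by (auto simp: tile_data_def)
  have "\<not> vertices \<sigma> \<subseteq> M"
  proof
    assume "vertices \<sigma> \<subseteq> M"
    then have "M = vertices \<sigma>" using d'(2) by blast
    moreover have "vertices \<sigma> \<noteq> {}" using complex_vertices(3)[OF K s(1)] s(2) by auto
    ultimately show False using d'(3) by simp
  qed
  then show ?thesis
    unfolding tile_meets_rel_interior_iff[OF K s(1) d s(1) b] using d' by (simp add: tile_faces_def)
qed

text \<open>
  The tile contains the interior points of its simplex, so each of the two simplices lies in the other.
\<close>

lemma tile_data_unique_simplex:
  assumes K: "simplicial_complex K" and T: "T \<noteq> {}"
    and s: "\<sigma> \<in> K" "tile_data \<sigma> W M T" and s': "\<sigma>' \<in> K" "tile_data \<sigma>' W' M' T"
  shows "\<sigma> = \<sigma>'"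
proof -
  have sub: "\<sigma> \<subseteq> \<sigma>'" if h: "\<sigma> \<in> K" "tile_data \<sigma> W M T" "\<sigma>' \<in> K" "tile_data \<sigma>' W' M' T" for \<sigma> \<sigma>' :: "'a set" and W M W' M'
  proof -
    have ne: "\<sigma> \<noteq> {}" using h(2) T by (auto simp: tile_data_def)
    then obtain b where b: "b \<in> rel_interior \<sigma>" using complex_rel_interior_point[OF K h(1)] by blast
    then have "b \<in> T" using tile_data_top_face[OF K h(1) ne h(2)] by blast
    then have "b \<in> \<sigma>'" using h(4) by (auto simp: tile_data_def)
    then show ?thesis using rel_interior_mem_iff[OF K h(1,3) b] by blast
  qed
  show ?thesis using sub[OF s s'] sub[OF s' s] by blast
qed

text \<open>
  Points in the relative interiors of the faces recover the face set of the tile from the point set.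
\<close>

lemma tile_data_unique:
  assumes K: "simplicial_complex K" and T: "T \<noteq> {}" and s: "\<sigma> \<in> K" and c: "card (vertices \<sigma>) \<ge> 2"
    and d: "tile_data \<sigma> W M T" "tile_data \<sigma> W' M' T"
  shows "W = W' \<and> M = M'"
proof (rule tile_faces_inject[of "vertices \<sigma>"])
  show "finite (vertices \<sigma>)" "2 \<le> card (vertices \<sigma>)" using complex_vertices(2)[OF K s] c by auto
  have sub: "tile_faces W (vertices \<sigma>) M \<subseteq> tile_faces W' (vertices \<sigma>) M'"
    if d: "tile_data \<sigma> W M T" "tile_data \<sigma> W' M' T" for W M W' M'
  proof
    fix U assume U: "U \<in> tile_faces W (vertices \<sigma>) M"
    then have US: "U \<subseteq> vertices \<sigma>" "U \<noteq> {}" by (auto simp: tile_faces_def)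
    note h = complex_hull_face[OF K s US(1)]
    have "convex hull U \<noteq> {}" using US(2) by simp
    then obtain b where b: "b \<in> rel_interior (convex hull U)" using complex_rel_interior_point[OF K h(1)] by blast
    then show "U \<in> tile_faces W' (vertices \<sigma>) M'"
      using tile_meets_rel_interior_iff[OF K s d(1) h(1) b] tile_meets_rel_interior_iff[OF K s d(2) h(1) b] U h(2) by simp
  qed
  show "tile_faces W (vertices \<sigma>) M = tile_faces W' (vertices \<sigma>) M'" using sub[OF d] sub[OF d(2,1)] by blast
qed (use d in \<open>auto simp: tile_data_def\<close>)


section \<open>Tilings of closed manifolds\<close>

locale morse_tiled_manifold =
  fixes K :: "'a::euclidean_space set set" and n :: nat and \<tau> :: "'a set set"
  assumes manifold: "closed_triangulated_manifold n K" and tiling: "morse_tiling K \<tau>"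
begin

lemma simplicial: "simplicial_complex K" and closed: "closed_manifold n (top_of_set (\<Union>K))"
  using manifold by (auto simp: closed_triangulated_manifold_def)

lemma finite_K: "finite K"
  using simplicial unfolding simplicial_complex_def by blast

lemma partition: "\<Union>\<tau> = \<Union>K" "T \<in> \<tau> \<Longrightarrow> T' \<in> \<tau> \<Longrightarrow> x \<in> T \<Longrightarrow> x \<in> T' \<Longrightarrow> T = T'" "T \<in> \<tau> \<Longrightarrow> T \<noteq> {}"
proof -
  have P: "partition_on (\<Union>K) \<tau>" using tiling unfolding morse_tiling_def by blast
  show "\<Union>\<tau> = \<Union>K" using P by (simp add: partition_on_def)
  show "T = T'" if "T \<in> \<tau>" "T' \<in> \<tau>" "x \<in> T" "x \<in> T'" for T T' x
    using P that unfolding partition_on_def disjoint_def by blast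
  show "T \<noteq> {}" if "T \<in> \<tau>" for T using P that unfolding partition_on_def by blast
qed

lemma morse_tile_dataE:
  assumes "morse_tile \<sigma> m k T"
  obtains W M where "tile_data \<sigma> W M T" "card W = k" "card (vertices \<sigma>) = m + 1"
proof -
  obtain \<mu> where mu: "morse_tile_with \<sigma> m k \<mu> T" using assms unfolding morse_tile_def by blast
  then have m: "int m simplex \<sigma>" unfolding morse_tile_with_def by blast
  have "card (vertices \<sigma>) = m + 1" using simplex_vertices(3)[OF m] by linarith
  then show thesis using that mu unfolding morse_tile_with_iff[OF m] by blast
qed

lemma card_vertices_le: "\<sigma> \<in> K \<Longrightarrow> \<sigma> \<noteq> {} \<Longrightarrow> card (vertices \<sigma>) \<le> n + 1"
proof -
  assume s: "\<sigma> \<in> K" "\<sigma> \<noteq> {}"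
  then obtain \<rho> where r: "\<rho> \<in> K" "\<sigma> \<subseteq> \<rho>" "card (vertices \<rho>) = n + 1" using manifold_pure[OF simplicial closed] by blast
  then have "vertices \<sigma> \<subseteq> vertices \<rho>" using complex_subset_iff[OF simplicial s(1)] by blast
  then show ?thesis using card_mono[OF complex_vertices(2)[OF simplicial r(1)]] r(3) by metis
qed

lemma top_simplex_maximal:
  assumes "\<sigma> \<in> K" "card (vertices \<sigma>) = n + 1" "\<rho> \<in> K" "\<sigma> \<subseteq> \<rho>"
  shows "\<rho> = \<sigma>"
proof -
  have sub: "vertices \<sigma> \<subseteq> vertices \<rho>" using complex_subset_iff[OF simplicial assms(1,3)] assms(4) by blast
  have "vertices \<sigma> \<noteq> {}" using assms(2) by auto
  then have "\<sigma> \<noteq> {}" using complex_vertices(3)[OF simplicial assms(1)] by auto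
  then have "card (vertices \<rho>) \<le> card (vertices \<sigma>)" using card_vertices_le[OF assms(3)] assms(2,4) by auto
  then have "vertices \<sigma> = vertices \<rho>" by (rule card_seteq[OF complex_vertices(2)[OF simplicial assms(3)] sub])
  then show ?thesis using complex_vertices(3)[OF simplicial assms(1)] complex_vertices(3)[OF simplicial assms(3)] by metis
qed

text \<open>
  The union of the tiles of dimension at least \<open>n\<close> is closed and contains the relative interiors of all
  \<open>n\<close>-simplices, hence these simplices themselves, hence the whole space because the complex is pure.
  As the tiles are disjoint, there is no room for further ones.
\<close>

lemma tile_top_dimensional:
  assumes T: "T \<in> \<tau>"
  shows "\<exists>\<sigma> W M. \<sigma> \<in> K \<and> card (vertices \<sigma>) = n + 1 \<and> tile_data \<sigma> W M T"
proof -
  define S where "S = {T \<in> \<tau>. \<exists>\<sigma>\<in>K. \<exists>m k. m \<ge> n \<and> morse_tile \<sigma> m k T}"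
  have "closedin (top_of_set (\<Union>K)) (\<Union>S)"
    using tiling unfolding morse_tiling_def S_def by blast
  moreover have "closed (\<Union>K)"
    using finite_K simplicial closed_simplex unfolding simplicial_complex_def by (intro closed_Union) blast+
  ultimately have clS: "closed (\<Union>S)" by (rule closedin_closed_trans)
  have top: "\<sigma> \<subseteq> \<Union>S" if s: "\<sigma> \<in> K" "card (vertices \<sigma>) = n + 1" for \<sigma>
  proof -
    have "rel_interior \<sigma> \<subseteq> \<Union>S"
    proof
      fix b assume b: "b \<in> rel_interior \<sigma>"
      then have "b \<in> \<Union>\<tau>" using s(1) rel_interior_subset partition(1) by blast
      then obtain T where T: "T \<in> \<tau>" "b \<in> T" by blast
      then obtain \<rho> m k where r: "\<rho> \<in> K" "morse_tile \<rho> m k T" using tiling unfolding morse_tiling_def by blast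
      obtain W M where d: "tile_data \<rho> W M T" "card (vertices \<rho>) = m + 1" using morse_tile_dataE[OF r(2)] by metis
      have "b \<in> \<rho>" using T(2) d(1) by (auto simp: tile_data_def)
      then have "\<sigma> \<subseteq> \<rho>" using rel_interior_mem_iff[OF simplicial s(1) r(1) b] by blast
      then have "\<rho> = \<sigma>" by (rule top_simplex_maximal[OF s r(1)])
      then have "m \<ge> n" using d(2) s(2) by simp
      then have "T \<in> S" using T(1) r unfolding S_def by blast
      then show "b \<in> \<Union>S" using T(2) by blast
    qed
    then have "closure (rel_interior \<sigma>) \<subseteq> \<Union>S" using clS by (rule closure_minimal)
    moreover have "convex \<sigma>" using s(1) simplicial convex_simplex unfolding simplicial_complex_def by blast
    ultimately show ?thesis using convex_closure_rel_interior closure_subset by blast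
  qed
  obtain t where t: "t \<in> T" using partition(3)[OF T] by blast
  then have "t \<in> \<Union>K" using T partition(1) by blast
  then obtain \<sigma> where s: "\<sigma> \<in> K" "t \<in> \<sigma>" by blast
  then obtain \<rho> where "\<rho> \<in> K" "\<sigma> \<subseteq> \<rho>" "card (vertices \<rho>) = n + 1" using manifold_pure[OF simplicial closed s(1)] by blast
  then have "t \<in> \<Union>S" using top s(2) by blast
  then obtain T' where T': "T' \<in> S" "t \<in> T'" by blast
  then have "T' = T" using partition(2)[OF _ T, of T' t] t unfolding S_def by blast
  then obtain \<sigma> m k where s: "\<sigma> \<in> K" "m \<ge> n" "morse_tile \<sigma> m k T" using T'(1) unfolding S_def by blast
  obtain W M where d: "tile_data \<sigma> W M T" "card (vertices \<sigma>) = m + 1" using morse_tile_dataE[OF s(3)] by metis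
  have "\<sigma> \<noteq> {}" using d(1) t by (auto simp: tile_data_def)
  then have "card (vertices \<sigma>) = n + 1" using card_vertices_le[OF s(1)] s(2) d(2) by simp
  then show ?thesis using s(1) d(1) by blast
qed

definition tile_simplex :: "'a set \<Rightarrow> 'a set" where
  "tile_simplex T = (SOME \<sigma>. \<sigma> \<in> K \<and> card (vertices \<sigma>) = n + 1 \<and> (\<exists>W M. tile_data \<sigma> W M T))"

definition tile_restriction :: "'a set \<Rightarrow> 'a set" where
  "tile_restriction T = (SOME W. \<exists>M. tile_data (tile_simplex T) W M T)"

definition tile_morse :: "'a set \<Rightarrow> 'a set" where
  "tile_morse T = (SOME M. tile_data (tile_simplex T) (tile_restriction T) M T)"

lemma tile:
  assumes "T \<in> \<tau>"
  shows "tile_simplex T \<in> K" "card (vertices (tile_simplex T)) = n + 1"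
    "tile_data (tile_simplex T) (tile_restriction T) (tile_morse T) T"
proof -
  have *: "tile_simplex T \<in> K \<and> card (vertices (tile_simplex T)) = n + 1 \<and> (\<exists>W M. tile_data (tile_simplex T) W M T)"
    unfolding tile_simplex_def by (rule someI_ex) (use tile_top_dimensional[OF assms] in blast)
  then show "tile_simplex T \<in> K" "card (vertices (tile_simplex T)) = n + 1" by blast+
  from * have ex: "\<exists>W M. tile_data (tile_simplex T) W M T" by blast
  have "\<exists>M. tile_data (tile_simplex T) (tile_restriction T) M T"
    unfolding tile_restriction_def by (rule someI_ex[OF ex])
  then show "tile_data (tile_simplex T) (tile_restriction T) (tile_morse T) T"
    unfolding tile_morse_def by (rule someI_ex)
qed

lemma tile_simplex_nonempty:
  assumes "T \<in> \<tau>"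
  shows "tile_simplex T \<noteq> {}"
proof -
  have "T \<subseteq> tile_simplex T" using tile(3)[OF assms] unfolding tile_data_def by blast
  then show ?thesis using partition(3)[OF assms] by blast
qed

text \<open>
  The point set of a tile determines its simplex, its order and its Morse face, so both vectors can be
  read off from one choice of tile data.
\<close>

lemma morse_tile_with_tile_iff:
  assumes T: "T \<in> \<tau>" and s: "\<sigma> \<in> K" and n: "n \<ge> 1"
  shows "morse_tile_with \<sigma> m k \<mu> T \<longleftrightarrow>
     \<sigma> = tile_simplex T \<and> m = n \<and> k = card (tile_restriction T) \<and> \<mu> = convex hull (tile_morse T)"
proof
  assume mt: "morse_tile_with \<sigma> m k \<mu> T"
  then have m: "int m simplex \<sigma>" unfolding morse_tile_with_def by blast
  obtain W M where d: "tile_data \<sigma> W M T" "card W = k" "\<mu> = convex hull M"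
    using mt unfolding morse_tile_with_iff[OF m] by blast
  have eq: "\<sigma> = tile_simplex T"
    using tile_data_unique_simplex[OF simplicial partition(3)[OF T] s d(1) tile(1,3)[OF T]] .
  have "card (vertices \<sigma>) = n + 1" using tile(2)[OF T] eq by simp
  then have "m = n" "card (vertices \<sigma>) \<ge> 2" using simplex_vertices(3)[OF m] n by auto
  moreover have "W = tile_restriction T \<and> M = tile_morse T"
    using tile_data_unique[OF simplicial partition(3)[OF T] s calculation(2) d(1)] tile(3)[OF T] unfolding eq by blast
  ultimately show "\<sigma> = tile_simplex T \<and> m = n \<and> k = card (tile_restriction T) \<and> \<mu> = convex hull (tile_morse T)"
    using eq d by blast
next
  assume a: "\<sigma> = tile_simplex T \<and> m = n \<and> k = card (tile_restriction T) \<and> \<mu> = convex hull (tile_morse T)"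
  obtain j where j: "j simplex \<sigma>" using simplicial s unfolding simplicial_complex_def by blast
  have "j = int m" using simplex_vertices(3)[OF j] tile(2)[OF T] a by simp
  then have m: "int m simplex \<sigma>" using j by simp
  show "morse_tile_with \<sigma> m k \<mu> T" unfolding morse_tile_with_iff[OF m] using tile(3)[OF T] a by blast
qed

text \<open>
  Interior points of the simplices translate the partition of the space into tiles into a partition of
  the set of simplices.
\<close>

lemma tiled_complex:
  assumes n: "n \<ge> 1"
  shows "tiled_complex (vertices ` (K - {{}})) \<tau> (\<lambda>T. vertices (tile_simplex T)) tile_restriction tile_morse (n + 1)"
proof
  have inj: "inj_on vertices K" by (rule inj_on_inverseI[of _ "\<lambda>V. convex hull V"]) (rule complex_vertices(3)[OF simplicial])
  have point: "\<exists>b. b \<in> rel_interior \<rho>" if "\<rho> \<in> K" "\<rho> \<noteq> {}" for \<rho>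
    using complex_rel_interior_point[OF simplicial that] by blast
  show "finite (vertices ` (K - {{}}))" using finite_K by simp
  show "finite \<sigma>" if "\<sigma> \<in> vertices ` (K - {{}})" for \<sigma> using that complex_vertices(2)[OF simplicial] by blast
  have ne: "vertices \<rho> \<noteq> {}" if "\<rho> \<in> K" "\<rho> \<noteq> {}" for \<rho>
    using complex_vertices(3)[OF simplicial that(1)] that(2) by auto
  then show "\<sigma> \<noteq> {}" if "\<sigma> \<in> vertices ` (K - {{}})" for \<sigma> using that by blast
  have face: "U \<in> vertices ` (K - {{}})" if "\<rho> \<in> K" "U \<subseteq> vertices \<rho>" "U \<noteq> {}" for U \<rho>
    using complex_hull_face[OF simplicial that(1,2)] that(3) by (intro image_eqI[of _ _ "convex hull U"]) auto
  then show "\<rho> \<in> vertices ` (K - {{}})" if "\<sigma> \<in> vertices ` (K - {{}})" "\<rho> \<subseteq> \<sigma>" "\<rho> \<noteq> {}" for \<sigma> \<rho>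
    using that by blast
  show "(\<Sum>\<rho> | \<rho> \<in> vertices ` (K - {{}}) \<and> \<sigma> \<subseteq> \<rho>. (-1) ^ card \<rho>) = ((-1) ^ (n + 1) :: real)"
    if s: "\<sigma> \<in> vertices ` (K - {{}})" for \<sigma>
  proof -
    obtain \<upsilon> where u: "\<upsilon> \<in> K" "\<upsilon> \<noteq> {}" "\<sigma> = vertices \<upsilon>" using s by blast
    have "{\<rho>. \<rho> \<in> vertices ` (K - {{}}) \<and> \<sigma> \<subseteq> \<rho>} = vertices ` {\<rho>. \<rho> \<in> K \<and> \<upsilon> \<subseteq> \<rho>}"
      using complex_subset_iff[OF simplicial u(1)] u by auto
    then have "(\<Sum>\<rho> | \<rho> \<in> vertices ` (K - {{}}) \<and> \<sigma> \<subseteq> \<rho>. (-1) ^ card \<rho>)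
        = (\<Sum>\<rho> | \<rho> \<in> K \<and> \<upsilon> \<subseteq> \<rho>. (-1 :: real) ^ card (vertices \<rho>))"
      by (simp add: sum.reindex inj_on_subset[OF inj])
    also have "\<dots> = real_of_int (\<Sum>\<rho> | \<rho> \<in> K \<and> \<upsilon> \<subseteq> \<rho>. (-1) ^ card (vertices \<rho>))" by simp
    also have "\<dots> = real_of_int ((-1) ^ (n + 1))" by (simp only: manifold_star_euler_char[OF simplicial closed u(1,2)])
    finally show ?thesis by simp
  qed
  show "2 \<le> n + 1" using n by simp
  show "card (vertices (tile_simplex T)) = n + 1" if "T \<in> \<tau>" for T by (rule tile(2)[OF that])
  have data: "tile_restriction T \<subseteq> vertices (tile_simplex T)" "tile_morse T \<subseteq> vertices (tile_simplex T)"
      "tile_morse T \<noteq> {} \<Longrightarrow> tile_restriction T \<noteq> {} \<and> tile_restriction T \<subseteq> tile_morse T \<and> card (tile_morse T) + 2 \<le> n + 1"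
    if "T \<in> \<tau>" for T
    using tile(2,3)[OF that] by (auto simp: tile_data_def)
  show "tile_restriction T \<subseteq> vertices (tile_simplex T)" if "T \<in> \<tau>" for T by (rule data(1)[OF that])
  show "tile_restriction T \<noteq> {} \<and> tile_restriction T \<subseteq> tile_morse T \<and>
      tile_morse T \<subseteq> vertices (tile_simplex T) \<and> card (tile_morse T) + 2 \<le> n + 1"
    if "T \<in> \<tau>" "tile_morse T \<noteq> {}" for T using data[OF that(1)] that(2) by blast
  show "finite \<tau>"
  proof (rule inj_on_finite[of tile_simplex])
    show "inj_on tile_simplex \<tau>"
    proof (rule inj_onI)
      fix T T' assume T: "T \<in> \<tau>" "T' \<in> \<tau>" "tile_simplex T = tile_simplex T'"
      obtain b where "b \<in> rel_interior (tile_simplex T)"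
        using point[OF tile(1)[OF T(1)] tile_simplex_nonempty[OF T(1)]] by blast
      then have "b \<in> T" "b \<in> T'"
        using tile_data_top_face[OF simplicial tile(1)[OF T(1)] tile_simplex_nonempty[OF T(1)] tile(3)[OF T(1)]]
          tile_data_top_face[OF simplicial tile(1)[OF T(2)] tile_simplex_nonempty[OF T(2)] tile(3)[OF T(2)]] T(3) by auto
      then show "T = T'" using partition(2) T by blast
    qed
    show "tile_simplex ` \<tau> \<subseteq> K" using tile(1) by blast
  qed (rule finite_K)
  show "vertices ` (K - {{}}) = (\<Union>T\<in>\<tau>. tile_faces (tile_restriction T) (vertices (tile_simplex T)) (tile_morse T))"
  proof (intro equalityI subsetI)
    fix U assume "U \<in> vertices ` (K - {{}})"
    then obtain \<rho> where r: "\<rho> \<in> K" "\<rho> \<noteq> {}" "U = vertices \<rho>" by blast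
    obtain b where b: "b \<in> rel_interior \<rho>" using point[OF r(1,2)] by blast
    then have "b \<in> \<Union>\<tau>" using r(1) rel_interior_subset partition(1) by blast
    then obtain T where T: "T \<in> \<tau>" "b \<in> T" by blast
    then have "U \<in> tile_faces (tile_restriction T) (vertices (tile_simplex T)) (tile_morse T)"
      using tile_meets_rel_interior_iff[OF simplicial tile(1,3)[OF T(1)] r(1) b] r(3) by simp
    then show "U \<in> (\<Union>T\<in>\<tau>. tile_faces (tile_restriction T) (vertices (tile_simplex T)) (tile_morse T))" using T(1) by blast
  next
    fix U assume "U \<in> (\<Union>T\<in>\<tau>. tile_faces (tile_restriction T) (vertices (tile_simplex T)) (tile_morse T))"
    then obtain T where T: "T \<in> \<tau>" "U \<in> tile_faces (tile_restriction T) (vertices (tile_simplex T)) (tile_morse T)" by blast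
    then have "U \<subseteq> vertices (tile_simplex T)" "U \<noteq> {}" by (auto simp: tile_faces_def)
    then show "U \<in> vertices ` (K - {{}})" by (rule face[OF tile(1)[OF T(1)]])
  qed
  show "disjoint_family_on (\<lambda>T. tile_faces (tile_restriction T) (vertices (tile_simplex T)) (tile_morse T)) \<tau>"
    unfolding disjoint_family_on_def
  proof (intro ballI impI equals0I)
    fix T T' U assume T: "T \<in> \<tau>" "T' \<in> \<tau>" "T \<noteq> T'"
      and "U \<in> tile_faces (tile_restriction T) (vertices (tile_simplex T)) (tile_morse T) \<inter>
             tile_faces (tile_restriction T') (vertices (tile_simplex T')) (tile_morse T')"
    then have U: "U \<in> tile_faces (tile_restriction T) (vertices (tile_simplex T)) (tile_morse T)"
      "U \<in> tile_faces (tile_restriction T') (vertices (tile_simplex T')) (tile_morse T')" by blast+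
    then have "U \<subseteq> vertices (tile_simplex T)" "U \<noteq> {}" by (auto simp: tile_faces_def)
    then have "U \<in> vertices ` (K - {{}})" by (rule face[OF tile(1)[OF T(1)]])
    then obtain \<rho> where r: "\<rho> \<in> K" "\<rho> \<noteq> {}" "U = vertices \<rho>" by blast
    obtain b where b: "b \<in> rel_interior \<rho>" using point[OF r(1,2)] by blast
    have "b \<in> T" "b \<in> T'"
      using tile_meets_rel_interior_iff[OF simplicial tile(1,3)[OF T(1)] r(1) b]
        tile_meets_rel_interior_iff[OF simplicial tile(1,3)[OF T(2)] r(1) b] U r(3) by auto
    then show False using partition(2) T by blast
  qed
qed

lemma h_vector_eq:
  assumes n: "n \<ge> 1"
  shows "h_vector K \<tau> k = card {T \<in> \<tau>. card (tile_restriction T) = k}"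
proof -
  have "(\<exists>\<sigma>\<in>K. \<exists>m. morse_tile \<sigma> m k T) \<longleftrightarrow> card (tile_restriction T) = k" if T: "T \<in> \<tau>" for T
  proof
    assume "\<exists>\<sigma>\<in>K. \<exists>m. morse_tile \<sigma> m k T"
    then obtain \<sigma> m \<mu> where s: "\<sigma> \<in> K" and "morse_tile_with \<sigma> m k \<mu> T" unfolding morse_tile_def by blast
    then show "card (tile_restriction T) = k" unfolding morse_tile_with_tile_iff[OF T s n] by simp
  next
    assume "card (tile_restriction T) = k"
    then have "morse_tile_with (tile_simplex T) n k (convex hull (tile_morse T)) T"
      unfolding morse_tile_with_tile_iff[OF T tile(1)[OF T] n] by simp
    then show "\<exists>\<sigma>\<in>K. \<exists>m. morse_tile \<sigma> m k T" unfolding morse_tile_def using tile(1)[OF T] by blast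
  qed
  then have "{T \<in> \<tau>. \<exists>\<sigma>\<in>K. \<exists>m. morse_tile \<sigma> m k T} = {T \<in> \<tau>. card (tile_restriction T) = k}" by blast
  then show ?thesis unfolding h_vector_def by (rule arg_cong)
qed

lemma basic_tile_iff: "basic_tile \<sigma> m k T \<longleftrightarrow> morse_tile_with \<sigma> m k {} T"
  unfolding basic_tile_def morse_tile_with_def by auto

text \<open>
  A Morse face of dimension \<open>i - 1\<close> on a tile of order \<open>i\<close> is spanned by \<open>i\<close> vertices, among them the \<open>i\<close>
  elements of \<open>W\<close>; so it equals the face spanned by \<open>W\<close>.
\<close>

lemma c_vector_eq:
  assumes n: "n \<ge> 1" and "i \<le> n"
  shows "c_vector K \<tau> i =
    (if i = 0 then card {T \<in> \<tau>. card (tile_restriction T) = 0}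
     else if i = n then card {T \<in> \<tau>. card (tile_restriction T) = n + 1}
     else card {T \<in> \<tau>. card (tile_restriction T) = i \<and> tile_morse T = tile_restriction T})"
proof -
  interpret tiled_complex "vertices ` (K - {{}})" \<tau> "\<lambda>T. vertices (tile_simplex T)" tile_restriction tile_morse "n + 1"
    by (rule tiled_complex[OF n])
  have "(\<exists>\<sigma>\<in>K. \<exists>m. critical_tile \<sigma> m i T) \<longleftrightarrow>
      (if i = 0 then card (tile_restriction T) = 0
       else if i = n then card (tile_restriction T) = n + 1
       else card (tile_restriction T) = i \<and> tile_morse T = tile_restriction T)" if T: "T \<in> \<tau>" for T
  proof -
    let ?W = "tile_restriction T" and ?M = "tile_morse T"
    have WM: "?M \<noteq> {} \<Longrightarrow> ?W \<noteq> {} \<and> ?W \<subseteq> ?M \<and> card ?M + 2 \<le> n + 1" using morse_face[OF T] by blast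
    have fin: "finite ?W" "finite ?M" using finite_W[OF T] finite_M[OF T] by auto
    have ind: "\<not> affine_dependent (vertices (tile_simplex T))" by (rule complex_vertices(1)[OF simplicial tile(1)[OF T]])
    have MV: "?M \<subseteq> vertices (tile_simplex T)" using tile(3)[OF T] by (simp add: tile_data_def)
    have emptyM: "{} = convex hull ?M \<longleftrightarrow> ?M = {}" by (metis convex_hull_eq_empty)
    have dimM: "aff_dim (convex hull ?M) = int (card ?M) - 1" by (rule aff_dim_hull_subset[OF ind MV])
    have "(\<exists>\<sigma>\<in>K. \<exists>m. critical_tile \<sigma> m i T) \<longleftrightarrow>
       i = 0 \<and> card ?W = 0 \<and> ?M = {} \<or> i = n \<and> card ?W = n + 1 \<and> ?M = {} \<or>
       1 \<le> i \<and> i < n \<and> card ?W = i \<and> int (card ?M) - 1 = int i - 1"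
      (is "?L \<longleftrightarrow> ?R")
    proof
      assume ?L
      then obtain \<sigma> m where s: "\<sigma> \<in> K" and crit: "critical_tile \<sigma> m i T" by blast
      consider "i = 0" "0 = card ?W" "?M = {}" | "i = n" "n + 1 = card ?W" "?M = {}"
        | "1 \<le> i" "i < n" "i = card ?W" "aff_dim (convex hull ?M) = int i - 1"
        using crit unfolding critical_tile_def basic_tile_iff morse_tile_with_tile_iff[OF T s n] emptyM by blast
      then show ?R unfolding dimM by cases simp_all
    next
      assume ?R
      then have "critical_tile (tile_simplex T) n i T"
        unfolding critical_tile_def basic_tile_iff morse_tile_with_tile_iff[OF T tile(1)[OF T] n] emptyM
        by (elim disjE conjE) (simp_all add: dimM)
      then show ?L using tile(1)[OF T] by blast
    qed
    also have "\<dots> \<longleftrightarrow> i = 0 \<and> card ?W = 0 \<or> i = n \<and> card ?W = n + 1 \<or> 1 \<le> i \<and> i < n \<and> card ?W = i \<and> ?M = ?W"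
    proof -
      have "?M = {}" if "card ?W = 0" using that WM fin by auto
      moreover have "?M = {}" if W: "card ?W = n + 1"
      proof (rule ccontr)
        assume "?M \<noteq> {}"
        then have "?W \<subseteq> ?M" "card ?M + 2 \<le> n + 1" using WM by auto
        then show False using card_mono[OF fin(2), of ?W] W by simp
      qed
      moreover have "?M = ?W" if "1 \<le> i" "card ?W = i" "int (card ?M) - 1 = int i - 1"
      proof -
        have "card ?M = card ?W" "?M \<noteq> {}" using that by auto
        then show ?thesis using WM card_subset_eq[OF fin(2), of ?W] by auto
      qed
      ultimately show ?thesis by auto
    qed
    finally show ?thesis using n \<open>i \<le> n\<close> by auto
  qed
  then have "{T \<in> \<tau>. \<exists>\<sigma>\<in>K. \<exists>m. critical_tile \<sigma> m i T} = {T \<in> \<tau>. (if i = 0 then card (tile_restriction T) = 0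
       else if i = n then card (tile_restriction T) = n + 1
       else card (tile_restriction T) = i \<and> tile_morse T = tile_restriction T)}" by blast
  then show ?thesis unfolding c_vector_def by simp
qed

lemma palindromic_cong: "(\<And>i. i \<le> N \<Longrightarrow> u i = v i) \<Longrightarrow> palindromic N u \<longleftrightarrow> palindromic N v"
  by (auto simp: palindromic_def)

lemma palindromic_iff_combinatorial:
  assumes n: "n \<ge> 1"
  shows "palindromic (n + 1) (h_vector K \<tau>) \<longleftrightarrow> palindromic (n + 1) (tiled_complex.h \<tau> tile_restriction)"
    "palindromic n (c_vector K \<tau>) \<longleftrightarrow> palindromic n (tiled_complex.c \<tau> tile_restriction tile_morse (n + 1))"
proof -
  interpret tiled_complex "vertices ` (K - {{}})" \<tau> "\<lambda>T. vertices (tile_simplex T)" tile_restriction tile_morse "n + 1"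
    by (rule tiled_complex[OF n])
  have "h_vector K \<tau> k = h k" for k by (simp add: h_vector_eq[OF n] h_def)
  then show "palindromic (n + 1) (h_vector K \<tau>) \<longleftrightarrow> palindromic (n + 1) h" by (simp add: palindromic_def)
  show "palindromic n (c_vector K \<tau>) \<longleftrightarrow> palindromic n c"
  proof (rule palindromic_cong)
    fix i assume "i \<le> n"
    show "c_vector K \<tau> i = c i" unfolding c_vector_eq[OF n \<open>i \<le> n\<close>] c_def h_def by simp
  qed
qed

text \<open>
  A tile in dimension zero is a single point, which has order \<open>0\<close> and order \<open>1\<close> at the same time, so both
  entries of the h-vector count all tiles.
\<close>

lemma zero_dimensional_palindromic:
  assumes "n = 0"
  shows "palindromic (n + 1) (h_vector K \<tau>)" "palindromic n (c_vector K \<tau>)"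
proof -
  have "\<exists>\<sigma>\<in>K. \<exists>m. morse_tile \<sigma> m k T" if T: "T \<in> \<tau>" and k: "k \<le> 1" for T k
  proof -
    let ?\<sigma> = "tile_simplex T"
    obtain v where v: "vertices ?\<sigma> = {v}" using tile(2)[OF T] assms by (auto simp: card_1_singleton_iff)
    have "tile_morse T = {}" "tile_restriction T \<subseteq> {v}" using tile(3)[OF T] v by (auto simp: tile_data_def)
    moreover have no_facet: "(\<Union>w\<in>W. convex hull ({v} - {w})) = {}" if "W \<subseteq> {v}" for W
      using that by (cases "W = {}") (auto simp: subset_singleton_iff)
    ultimately have "T = ?\<sigma>" using tile(3)[OF T] v unfolding tile_data_def by simp
    then have d: "tile_data ?\<sigma> W {} T" if "W \<subseteq> {v}" for W using that v no_facet[OF that] by (simp add: tile_data_def)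
    obtain W where "W \<subseteq> {v}" "card W = k"
    proof (cases k)
      case 0
      then show thesis using that[of "{}"] by simp
    next
      case (Suc j)
      then show thesis using that[of "{v}"] k by simp
    qed
    obtain j where j: "j simplex ?\<sigma>" using simplicial tile(1)[OF T] unfolding simplicial_complex_def by blast
    then have "int 0 simplex ?\<sigma>" using simplex_vertices(3)[OF j] v by simp
    from morse_tile_with_iff[OF this] have "morse_tile_with ?\<sigma> 0 k (convex hull {}) T"
      using d \<open>W \<subseteq> {v}\<close> \<open>card W = k\<close> by blast
    then show ?thesis using tile(1)[OF T] unfolding morse_tile_def by blast
  qed
  then have "h_vector K \<tau> k = card \<tau>" if "k \<le> 1" for k
    unfolding h_vector_def using that by (intro arg_cong[of _ _ card]) blast
  then show "palindromic (n + 1) (h_vector K \<tau>)" using assms by (simp add: palindromic_def)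
  show "palindromic n (c_vector K \<tau>)" using assms by (simp add: palindromic_def)
qed

theorem h_tiling_palindromic_iff:
  assumes "h_tiling K \<tau>"
  shows "palindromic (n + 1) (h_vector K \<tau>) \<longleftrightarrow> palindromic n (c_vector K \<tau>)"
proof (cases "n = 0")
  case False
  then have n: "n \<ge> 1" by simp
  interpret tiled_complex "vertices ` (K - {{}})" \<tau> "\<lambda>T. vertices (tile_simplex T)" tile_restriction tile_morse "n + 1"
    by (rule tiled_complex[OF n])
  have "tile_morse T = {}" if T: "T \<in> \<tau>" for T
  proof -
    obtain \<sigma> m k where "\<sigma> \<in> K" "morse_tile_with \<sigma> m k {} T"
      using assms T unfolding h_tiling_def basic_tile_iff by blast
    then have "{} = convex hull (tile_morse T)" using morse_tile_with_tile_iff[OF T _ n] by fast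
    then show ?thesis by (metis convex_hull_eq_empty)
  qed
  then show ?thesis using basic_palindromic_iff palindromic_iff_combinatorial[OF n] by simp
qed (use zero_dimensional_palindromic in simp)

theorem low_dimensional_palindromic_iff:
  assumes "n < 4"
  shows "palindromic (n + 1) (h_vector K \<tau>) \<longleftrightarrow> palindromic n (c_vector K \<tau>)"
proof (cases "n = 0")
  case False
  then have n: "n \<ge> 1" by simp
  interpret tiled_complex "vertices ` (K - {{}})" \<tau> "\<lambda>T. vertices (tile_simplex T)" tile_restriction tile_morse "n + 1"
    by (rule tiled_complex[OF n])
  show ?thesis using low_dimension_palindromic_iff palindromic_iff_combinatorial[OF n] assms by simp
qed (use zero_dimensional_palindromic in simp)

end

theorem theorem1p3:
  fixes K :: "'a::euclidean_space set set" and n :: nat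
  assumes "closed_triangulated_manifold n K"
  shows "(\<forall>\<tau>. h_tiling K \<tau> \<longrightarrow>
            (palindromic (n + 1) (h_vector K \<tau>) \<longleftrightarrow> palindromic n (c_vector K \<tau>))) \<and>
         (n < 4 \<longrightarrow> (\<forall>\<tau>. morse_tiling K \<tau> \<longrightarrow>
            (palindromic (n + 1) (h_vector K \<tau>) \<longleftrightarrow> palindromic n (c_vector K \<tau>))))"
proof (intro conjI allI impI)
  fix \<tau> assume h: "h_tiling K \<tau>"
  then interpret morse_tiled_manifold K n \<tau>
    using assms by unfold_locales (auto simp: h_tiling_def)
  show "palindromic (n + 1) (h_vector K \<tau>) \<longleftrightarrow> palindromic n (c_vector K \<tau>)"
    by (rule h_tiling_palindromic_iff[OF h])
next
  fix \<tau> assume "n < 4" "morse_tiling K \<tau>"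
  then interpret morse_tiled_manifold K n \<tau>
    using assms by unfold_locales
  show "palindromic (n + 1) (h_vector K \<tau>) \<longleftrightarrow> palindromic n (c_vector K \<tau>)"
    by (rule low_dimensional_palindromic_iff[OF \<open>n < 4\<close>])
qed

end
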